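(* A lopsp-operation $O$ can be written as an lsp-operation if and only if $O$ has an orientation-reversing automorphism that fixes $v_0$, $v_1$ and $v_2$.
   Context: A map is a connected multigraph (loops and parallel edges allowed) 2-cell embedded in a closed orientable surface; combinatorially it is given by its set $E'$ of directed edges (two per edge, also for loops), the involution $\theta$ sending a directed edge to its reverse, and a permutation $\sigma$ of $E'$ preserving start vertices that induces the cyclic order of directed edges around each vertex. Plane means embedded in the sphere. An orientation-reversing automorphism of a map is a bijection $\phi:E'\to E'$ with $\theta\circ\phi=\phi\circ\theta$ and $\sigma^{-1}\circ\phi=\phi\circ\sigma$; it fixes a vertex if it maps the directed edges starting at that vertex to directed edges starting at that vertex. A lopsp-operation is a plane map $O$ with a colouring $c:V_O\to\{0,1,2\}$ and three marked vertices $v_0,v_1,v_2$ such that: (1) every face of $O$ is a triangle; (2) no edge joins two vertices of the same colour; (3) $c(v_0)\neq1$, $c(v_2)\neq1$, if $c(v_1)=1$ then $\deg(v_1)=2$, and every vertex $v\notin\{v_0,v_1,v_2\}$ with $c(v)=1$ has degree 4. An lsp-operation is a 2-connected plane map $L$ with a colouring $c:V_L\to\{0,1,2\}$, one face designated as the outer face, and three vertices $v_0,v_1,v_2$ on the outer face, such that: every face other than the outer face is a triangle; no edge joins two vertices of the same colour; every vertex $v$ not on the outer face with $c(v)=1$ has degree 4; every vertex $v$ on the outer face other than $v_0,v_1,v_2$ with $c(v)=1$ has degree 3; $c(v_0),c(v_2)\neq1$; and if $c(v_1)=1$ then $\deg(v_1)=2$. The lopsp-operation corresponding to an lsp-operation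 $L$ is obtained by gluing a mirror-image copy of $L$ into the outer face of $L$, identifying the boundaries of the two outer faces (and the corresponding copies of $v_0,v_1,v_2$). A lopsp-operation can be written as an lsp-operation if it is (isomorphic, as a coloured map with marked vertices, to) the lopsp-operation corresponding to some lsp-operation; equivalently, if there is a cycle in $O$ containing $v_0,v_1,v_2$ such that one side of the cycle is the mirror image of the other side. *)

theory Defs
  imports "Graph_Theory.Digraph_Component" "HOL-Combinatorics.Orbits"
begin

text \<open>
  A map is given by its finite set of darts (directed edges), the reversal \<open>theta\<close> and the rotation
  \<open>sigma\<close>. Vertices are the cycles of \<open>sigma\<close>: a vertex is the set of darts starting at it. Reading
  \<open>sigma\<close> counterclockwise, the dart following \<open>d\<close> on the boundary of the face to the left of \<open>d\<close> is
  the one preceding \<open>theta d\<close> in the rotation around the end of \<open>d\<close>. A face is the set of darts that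
  have it on their left; the corners of the face lie between \<open>d\<close> and \<open>sigma d\<close> for \<open>d\<close> in this set.
\<close>

record 'a cmap =
  darts :: "'a set"
  theta :: "'a \<Rightarrow> 'a"
  sigma :: "'a \<Rightarrow> 'a"

definition vertex_of :: "('a, 'm) cmap_scheme \<Rightarrow> 'a \<Rightarrow> 'a set" where
  "vertex_of M d = orbit (sigma M) d"

definition vertices :: "('a, 'm) cmap_scheme \<Rightarrow> 'a set set" where
  "vertices M = vertex_of M ` darts M"

definition edges :: "('a, 'm) cmap_scheme \<Rightarrow> 'a set set" where
  "edges M = (\<lambda>d. {d, theta M d}) ` darts M"

definition face_next :: "('a, 'm) cmap_scheme \<Rightarrow> 'a \<Rightarrow> 'a" where
  "face_next M d = inv (sigma M) (theta M d)"

definition faces :: "('a, 'm) cmap_scheme \<Rightarrow> 'a set set" where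
  "faces M = orbit (face_next M) ` darts M"

definition underlying_graph :: "('a, 'm) cmap_scheme \<Rightarrow> ('a set, 'a) pre_digraph" where
  "underlying_graph M = \<lparr> verts = vertices M, arcs = darts M,
     tail = vertex_of M, head = (\<lambda>d. vertex_of M (theta M d)) \<rparr>"

definition is_map :: "('a, 'm) cmap_scheme \<Rightarrow> bool" where
  "is_map M \<longleftrightarrow>
     finite (darts M) \<and>
     sigma M permutes darts M \<and>
     theta M permutes darts M \<and>
     (\<forall>d \<in> darts M. theta M d \<noteq> d \<and> theta M (theta M d) = d) \<and>
     connected (underlying_graph M)"

text \<open>
  The surface of a map is closed, connected and orientable, so it is the sphere iff its Euler
  characteristic is 2.
\<close>

definition plane_map :: "('a, 'm) cmap_scheme \<Rightarrow> bool" where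
  "plane_map M \<longleftrightarrow> is_map M \<and>
     int (card (vertices M)) - int (card (edges M)) + int (card (faces M)) = 2"

definition two_connected :: "('a, 'm) cmap_scheme \<Rightarrow> bool" where
  "two_connected M \<longleftrightarrow>
     3 \<le> card (vertices M) \<and> connected (underlying_graph M) \<and>
     (\<forall>v \<in> vertices M. connected (pre_digraph.del_vert (underlying_graph M) v))"

text \<open>Since a vertex is the set of darts starting at it, its degree is its cardinality.\<close>

record 'a marked_map = "'a cmap" +
  colour :: "'a set \<Rightarrow> nat"
  v0 :: "'a set"
  v1 :: "'a set"
  v2 :: "'a set"

definition coloured_and_marked :: "('a, 'm) marked_map_scheme \<Rightarrow> bool" where
  "coloured_and_marked M \<longleftrightarrow>
     (\<forall>v \<in> vertices M. colour M v \<in> {0, 1, 2}) \<and>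
     (\<forall>d \<in> darts M. colour M (vertex_of M d) \<noteq> colour M (vertex_of M (theta M d))) \<and>
     v0 M \<in> vertices M \<and> v1 M \<in> vertices M \<and> v2 M \<in> vertices M \<and>
     distinct [v0 M, v1 M, v2 M] \<and>
     colour M (v0 M) \<noteq> 1 \<and> colour M (v2 M) \<noteq> 1 \<and>
     (colour M (v1 M) = 1 \<longrightarrow> card (v1 M) = 2)"

definition lopsp_operation :: "'a marked_map \<Rightarrow> bool" where
  "lopsp_operation Op \<longleftrightarrow>
     plane_map Op \<and> coloured_and_marked Op \<and>
     (\<forall>f \<in> faces Op. card f = 3) \<and>
     (\<forall>v \<in> vertices Op - {v0 Op, v1 Op, v2 Op}. colour Op v = 1 \<longrightarrow> card v = 4)"

record 'a lsp_map = "'a marked_map" +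
  outer :: "'a set"

text \<open>
  Every corner of the outer face is the one following a dart in \<open>outer\<close>, so a vertex lies on the
  outer face iff it contains such a dart.
\<close>

definition on_outer :: "'a lsp_map \<Rightarrow> 'a set \<Rightarrow> bool" where
  "on_outer L v \<longleftrightarrow> v \<inter> outer L \<noteq> {}"

definition lsp_operation :: "'a lsp_map \<Rightarrow> bool" where
  "lsp_operation L \<longleftrightarrow>
     plane_map L \<and> two_connected L \<and> coloured_and_marked L \<and>
     outer L \<in> faces L \<and>
     on_outer L (v0 L) \<and> on_outer L (v1 L) \<and> on_outer L (v2 L) \<and>
     (\<forall>f \<in> faces L - {outer L}. card f = 3) \<and>
     (\<forall>v \<in> vertices L. \<not> on_outer L v \<and> colour L v = 1 \<longrightarrow> card v = 4) \<and>
     (\<forall>v \<in> vertices L - {v0 L, v1 L, v2 L}. on_outer L v \<and> colour L v = 1 \<longrightarrow> card v = 3)"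

text \<open>
  Gluing a mirror image of \<open>L\<close> into its outer face, which is bounded by a simple cycle as \<open>L\<close> is
  2-connected. The dart \<open>(d, False)\<close> is \<open>d\<close> itself and \<open>(d, True)\<close> is its mirror image; the darts
  of the edges on the outer face are identified with their mirror images, so they occur with
  \<open>False\<close> only.
\<close>

definition boundary_darts :: "'a lsp_map \<Rightarrow> 'a set" where
  "boundary_darts L = outer L \<union> theta L ` outer L"

definition double_darts :: "'a lsp_map \<Rightarrow> ('a \<times> bool) set" where
  "double_darts L = darts L \<times> {False} \<union> (darts L - boundary_darts L) \<times> {True}"

definition mirror_dart :: "'a lsp_map \<Rightarrow> 'a \<Rightarrow> 'a \<times> bool" where
  "mirror_dart L d = (d, d \<notin> boundary_darts L)"

definition double_theta :: "'a lsp_map \<Rightarrow> 'a \<times> bool \<Rightarrow> 'a \<times> bool" where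
  "double_theta L p = (if p \<in> double_darts L then (theta L (fst p), snd p) else p)"

text \<open>
  The rotation of the mirror image is the inverse of that of \<open>L\<close>. A dart \<open>d\<close> in \<open>outer L\<close> is followed by
  the outer corner, where the mirror image has been inserted; so after \<open>d\<close> the rotation continues in
  the mirror image, and it returns to \<open>L\<close> at the other boundary dart of the vertex.
\<close>

definition double_sigma :: "'a lsp_map \<Rightarrow> 'a \<times> bool \<Rightarrow> 'a \<times> bool" where
  "double_sigma L p =
     (if p \<notin> double_darts L then p
      else if \<not> snd p \<and> fst p \<notin> outer L then (sigma L (fst p), False)
      else mirror_dart L (inv (sigma L) (fst p)))"

text \<open>
  A vertex of the double is a vertex of \<open>L\<close>, its mirror image, or (on the outer face) the union of
  both; in each case its colour is that of its first projection.
\<close>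

definition lopsp_of_lsp :: "'a lsp_map \<Rightarrow> ('a \<times> bool) marked_map" where
  "lopsp_of_lsp L =
     \<lparr> darts = double_darts L, theta = double_theta L, sigma = double_sigma L,
       colour = (\<lambda>v. colour L (fst ` v)),
       v0 = {p \<in> double_darts L. fst p \<in> v0 L},
       v1 = {p \<in> double_darts L. fst p \<in> v1 L},
       v2 = {p \<in> double_darts L. fst p \<in> v2 L} \<rparr>"

definition marked_map_iso :: "('a \<Rightarrow> 'b) \<Rightarrow> 'a marked_map \<Rightarrow> 'b marked_map \<Rightarrow> bool" where
  "marked_map_iso h M N \<longleftrightarrow>
     bij_betw h (darts M) (darts N) \<and>
     (\<forall>d \<in> darts M. h (theta M d) = theta N (h d) \<and> h (sigma M d) = sigma N (h d)) \<and>
     (\<forall>v \<in> vertices M. colour N (h ` v) = colour M v) \<and>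
     h ` v0 M = v0 N \<and> h ` v1 M = v1 N \<and> h ` v2 M = v2 N"

text \<open>
  Taking the darts of \<open>L\<close> from the same type as those of \<open>Op\<close> is no restriction: if the double of
  some \<open>L\<close> is isomorphic to \<open>Op\<close>, then \<open>d \<mapsto> (d, False)\<close> embeds the darts of \<open>L\<close> into those of \<open>Op\<close>,
  and \<open>L\<close> can be replaced by an isomorphic copy.
\<close>

definition can_be_written_as_lsp :: "'a marked_map \<Rightarrow> bool" where
  "can_be_written_as_lsp Op \<longleftrightarrow>
     (\<exists>(L :: 'a lsp_map) h. lsp_operation L \<and> marked_map_iso h (lopsp_of_lsp L) Op)"

definition orientation_reversing_automorphism :: "('a, 'm) cmap_scheme \<Rightarrow> ('a \<Rightarrow> 'a) \<Rightarrow> bool" where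
  "orientation_reversing_automorphism M \<phi> \<longleftrightarrow>
     bij_betw \<phi> (darts M) (darts M) \<and>
     (\<forall>d \<in> darts M. theta M (\<phi> d) = \<phi> (theta M d) \<and> inv (sigma M) (\<phi> d) = \<phi> (sigma M d))"

definition fixes_vertex :: "('a \<Rightarrow> 'a) \<Rightarrow> 'a set \<Rightarrow> bool" where
  "fixes_vertex \<phi> v \<longleftrightarrow> \<phi> ` v \<subseteq> v"

end

theory Submission
  imports Defs "HOL-Combinatorics.Cycles"
begin

text \<open>
  Gluing a mirror image to an lsp-operation yields an obvious reflection, provided that no edge has
  the outer face on both sides.

  Conversely, let \<open>\<phi>\<close> be an orientation-reversing automorphism fixing the marked vertices. It
  preserves the colours: otherwise it would swap two of them, and Euler's formula would leave only
  two vertices for the third one, the common colour of the marked vertices. So it fixes no triangle,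
  the axis of the reflection at a fixed vertex runs along edges, and every fixed vertex has exactly
  two fixed darts. Hence the fixed edges form a set of even degree everywhere. In a plane map, such
  a set bounds a set \<open>A\<close> of faces, since homology modulo 2 vanishes; this takes the place of the
  Jordan curve theorem. The reflection exchanges the two sides of every cycle of fixed edges, so
  there is only one such cycle, and the faces in \<open>A\<close> together with this cycle form the
  lsp-operation.
\<close>

section \<open>Orbits and connectivity\<close>

text \<open>The obstacle at a fixed vertex is that the axis might run through a corner and cross the
  opposite edge of a triangle. Colours exclude this: the neighbours of a vertex alternate between
  two colours, so a colour-preserving reflection moves a dart by an even number of rotation steps,
  and the dart halfway is fixed. Hence colours must be dealt with before any cycle is available. A
  set of faces is handled as the set of darts with one of them on the left. Reversing the
  orientation turns left into right, so it is \<open>\<phi> \<circ> \<theta>\<close>, not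
  \<open>\<phi>\<close>, that acts on faces. That an even set bounds is proved by counting alone:
  there are at least 2^(F-1) boundaries and at most 2^(E-V+1) even sets, and Euler's formula equates
  the exponents. This serves twice: to find \<open>A\<close>, and to show that the fixed edges do
  not split into several cycles. For the other direction, the double is known through its
  isomorphism with a lopsp-operation. Its rotation inherits surjectivity from there, which is what
  forbids an outer face on both sides of an edge.\<close>

lemma orbit_permutes_iff:
  assumes "finite S" "f permutes S"
  shows "e \<in> orbit f d \<longleftrightarrow> (\<exists>n. e = (f ^^ n) d)"
proof -
  have "permutation f" using assms by (auto simp: permutation_permutes)
  then show ?thesis by (auto simp: orbit_altdef_permutation)
qed

lemma self_in_orbit_permutes: "finite S \<Longrightarrow> f permutes S \<Longrightarrow> x \<in> orbit f x"
  by (rule permutation_self_in_orbit) (auto simp: permutation_permutes)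

lemma orbit_eq_permutes: "finite S \<Longrightarrow> f permutes S \<Longrightarrow> y \<in> orbit f x \<Longrightarrow> orbit f y = orbit f x"
  by (rule orbit_cyclic_eq3[OF cyclic_on_orbit])

text \<open>An injective self-map of a finite set is onto, so forward closure gives closure under
  the inverse. This is why closed sets of darts can be defined by a one-sided condition
  below.\<close>

lemma permutes_closed_iff:
  assumes "finite S" "f permutes S" "A \<subseteq> S" "\<And>x. x \<in> A \<Longrightarrow> f x \<in> A"
  shows "f x \<in> A \<longleftrightarrow> x \<in> A"
proof -
  have "inj f" using assms(2) permutes_inj by blast
  then have "inj_on f A" using inj_on_subset by blast
  moreover have "finite A" using assms(1,3) finite_subset by blast
  moreover have "f ` A \<subseteq> A" using assms(4) by auto
  ultimately have "f ` A = A" using endo_inj_surj by blast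
  then show ?thesis using \<open>inj f\<close> by (metis image_iff inj_eq)
qed

text \<open>The orbit is run through from \<open>f q\<close> once round to \<open>q\<close>; the
  step from \<open>q\<close> back to \<open>f q\<close> is never taken. Meant for a rotation that
  has a gap at one corner.\<close>

lemma orbit_constant:
  assumes "x \<in> orbit f q" "\<And>y. y \<in> orbit f q \<Longrightarrow> y \<noteq> q \<Longrightarrow> P (f y) = P y"
  shows "P x = P (f q)"
  using assms(1)
proof (induction rule: orbit.induct)
  case (step y)
  then show ?case using assms(2)[of y] by (cases "y = q") auto
qed simp

text \<open>Taking unions is a bijection from the subfamilies of \<open>P\<close> to the sets
  saturated for \<open>P\<close>.\<close>

lemma card_unions_of_disjoint:
  assumes "finite S" "\<Union>P = S" "pairwise disjnt P" "{} \<notin> P"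
  shows "card {A. A \<subseteq> S \<and> (\<forall>X\<in>P. X \<subseteq> A \<or> X \<inter> A = {})} = 2 ^ card P"
proof -
  have fin: "finite P" using assms(1,2) by (metis finite_UnionD)
  have inj: "inj_on Union (Pow P)"
  proof (rule inj_onI)
    have sub: "Q \<subseteq> R" if "Q \<subseteq> P" "R \<subseteq> P" "\<Union>Q = \<Union>R" for Q R
    proof
      fix X assume X: "X \<in> Q"
      then have XP: "X \<in> P" using that(1) by blast
      then obtain x where x: "x \<in> X" using assms(4) by (metis all_not_in_conv)
      then have "x \<in> \<Union>R" using X that(3) by blast
      then obtain Y where Y: "Y \<in> R" "x \<in> Y" by blast
      then have "Y \<in> P" using that(2) by blast
      then have "X = Y" using assms(3) XP x Y(2) unfolding pairwise_def disjnt_def by blast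
      then show "X \<in> R" using Y by simp
    qed
    fix Q R assume "Q \<in> Pow P" "R \<in> Pow P" "\<Union>Q = \<Union>R"
    then show "Q = R" using sub[of Q R] sub[of R Q] by auto
  qed
  have "{A. A \<subseteq> S \<and> (\<forall>X\<in>P. X \<subseteq> A \<or> X \<inter> A = {})} = Union ` Pow P"
  proof (intro subset_antisym subsetI)
    fix A assume "A \<in> {A. A \<subseteq> S \<and> (\<forall>X\<in>P. X \<subseteq> A \<or> X \<inter> A = {})}"
    then have A: "A \<subseteq> \<Union>P" "\<And>X. X \<in> P \<Longrightarrow> X \<subseteq> A \<or> X \<inter> A = {}"
      using assms(2) by auto
    have "A = \<Union>{X \<in> P. X \<subseteq> A}"
    proof
      show "A \<subseteq> \<Union>{X \<in> P. X \<subseteq> A}"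
      proof
        fix x assume x: "x \<in> A"
        then obtain X where "X \<in> P" "x \<in> X" using A(1) by auto
        then show "x \<in> \<Union>{X \<in> P. X \<subseteq> A}" using A(2)[of X] x by auto
      qed
    qed auto
    then show "A \<in> Union ` Pow P" by (intro image_eqI[of _ _ "{X \<in> P. X \<subseteq> A}"]) auto
  next
    fix A assume "A \<in> Union ` Pow P"
    then obtain Q where Q: "Q \<subseteq> P" "A = \<Union>Q" by auto
    have "X \<subseteq> A \<or> X \<inter> A = {}" if "X \<in> P" for X
    proof (cases "X \<in> Q")
      case False
      then have "X \<inter> Y = {}" if "Y \<in> Q" for Y
        using pairwiseD[OF assms(3) \<open>X \<in> P\<close>, of Y] Q(1) that by (auto simp: disjnt_def)
      then show ?thesis using Q(2) by auto
    qed (use Q in auto)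
    then show "A \<in> {A. A \<subseteq> S \<and> (\<forall>X\<in>P. X \<subseteq> A \<or> X \<inter> A = {})}"
      using Q assms(2) by auto
  qed
  then show ?thesis using inj fin by (simp add: card_image card_Pow)
qed

lemma orbits_partition:
  assumes "finite S" "f permutes S"
  shows "\<Union>(orbit f ` S) = S" "pairwise disjnt (orbit f ` S)" "{} \<notin> orbit f ` S"
proof -
  note self = self_in_orbit_permutes[OF assms] and eq = orbit_eq_permutes[OF assms]
  show "\<Union>(orbit f ` S) = S"
    using self permutes_orbit_subset[OF assms(2)] by blast
  show "pairwise disjnt (orbit f ` S)"
    unfolding pairwise_def disjnt_def using eq by blast
  show "{} \<notin> orbit f ` S" using self by blast
qed

text \<open>The closed sets are the unions of orbits. Applied to \<open>face_next\<close> and to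
  \<open>theta\<close>, this gives the sizes of the spaces of 2-chains and 1-chains modulo
  2.\<close>

lemma card_closed_sets:
  assumes "finite S" "f permutes S"
  shows "card {A. A \<subseteq> S \<and> f ` A \<subseteq> A} = 2 ^ card (orbit f ` S)"
proof -
  note self = self_in_orbit_permutes[OF assms]
  have "f ` A \<subseteq> A \<longleftrightarrow> (\<forall>X\<in>orbit f ` S. X \<subseteq> A \<or> X \<inter> A = {})" if "A \<subseteq> S" for A
  proof
    assume "f ` A \<subseteq> A"
    then have iff: "f x \<in> A \<longleftrightarrow> x \<in> A" for x
      using permutes_closed_iff[OF assms \<open>A \<subseteq> S\<close>] by blast
    have "y \<in> A \<longleftrightarrow> x \<in> A" if "y \<in> orbit f x" for x y
      using that by (induction rule: orbit.induct) (auto simp: iff)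
    then show "\<forall>X\<in>orbit f ` S. X \<subseteq> A \<or> X \<inter> A = {}" by blast
  next
    assume *: "\<forall>X\<in>orbit f ` S. X \<subseteq> A \<or> X \<inter> A = {}"
    show "f ` A \<subseteq> A"
    proof
      fix y assume "y \<in> f ` A"
      then obtain x where x: "x \<in> A" "y = f x" by auto
      then have "x \<in> orbit f x \<inter> A" using self by auto
      then have "orbit f x \<subseteq> A" using * x \<open>A \<subseteq> S\<close> by auto
      then show "y \<in> A" using orbit.base[of f x] x by auto
    qed
  qed
  then have "{A. A \<subseteq> S \<and> f ` A \<subseteq> A} = {A. A \<subseteq> S \<and> (\<forall>X\<in>orbit f ` S. X \<subseteq> A \<or> X \<inter> A = {})}"
    by blast
  then show ?thesis using card_unions_of_disjoint[OF assms(1) orbits_partition[OF assms]] by simp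
qed

lemma even_card_sym_diff:
  assumes "finite A" "finite B"
  shows "even (card (sym_diff A B)) \<longleftrightarrow> even (card A) = even (card B)"
proof -
  have "card A = card (A - B) + card (A \<inter> B)" "card B = card (B - A) + card (A \<inter> B)"
    using assms card_Int_Diff[of A B] card_Int_Diff[of B A] by (auto simp: Int_commute)
  moreover have "card (sym_diff A B) = card (A - B) + card (B - A)"
    using assms by (intro card_Un_disjoint) auto
  ultimately show ?thesis by presburger
qed

text \<open>Connectedness as absence of cuts. The vertices reachable from \<open>u\<close> form such
  a set \<open>S\<close>; in this form connectedness can be used as an induction principle.\<close>

lemma connected_iff_no_closed_set:
  assumes "\<And>a. a \<in> arcs G \<Longrightarrow> tail G a \<in> verts G \<and> head G a \<in> verts G"
  shows "connected G \<longleftrightarrow> verts G \<noteq> {} \<and>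
    (\<forall>S\<subseteq>verts G. S \<noteq> {} \<longrightarrow> (\<forall>a\<in>arcs G. tail G a \<in> S \<longleftrightarrow> head G a \<in> S) \<longrightarrow> S = verts G)"
proof -
  let ?E = "parcs (mk_symmetric G)"
  have conn: "connected G \<longleftrightarrow> verts G \<noteq> {} \<and>
      (\<forall>u\<in>verts G. \<forall>v\<in>verts G. (u, v) \<in> rtrancl_on (verts G) ?E)"
    by (simp add: connected_def strongly_connected_def reachable_def)
  have closed: "S = verts G"
    if R: "\<forall>u\<in>verts G. \<forall>v\<in>verts G. (u, v) \<in> rtrancl_on (verts G) ?E"
      and S: "S \<subseteq> verts G" "S \<noteq> {}" and cl: "\<forall>a\<in>arcs G. tail G a \<in> S \<longleftrightarrow> head G a \<in> S" for S
  proof -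
    obtain u where u: "u \<in> S" using S by blast
    have "v \<in> S" if "(u, v) \<in> rtrancl_on (verts G) ?E" for v
      using that by (induction rule: rtrancl_on_induct) (use u cl in \<open>auto simp: parcs_mk_symmetric\<close>)
    then show ?thesis using R S u by blast
  qed
  have reach: "(u, v) \<in> rtrancl_on (verts G) ?E"
    if cl: "\<forall>S\<subseteq>verts G. S \<noteq> {} \<longrightarrow> (\<forall>a\<in>arcs G. tail G a \<in> S \<longleftrightarrow> head G a \<in> S) \<longrightarrow> S = verts G"
      and uv: "u \<in> verts G" "v \<in> verts G" for u v
  proof -
    define S where "S = {w. (u, w) \<in> rtrancl_on (verts G) ?E}"
    have "S \<subseteq> verts G" unfolding S_def using in_rtrancl_on_in_F by fastforce
    moreover have "u \<in> S" unfolding S_def using uv by simp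
    moreover have "tail G a \<in> S \<longleftrightarrow> head G a \<in> S" if "a \<in> arcs G" for a
      using that assms unfolding S_def
      by (auto simp: parcs_mk_symmetric intro: rtrancl_on_into_rtrancl_on)
    ultimately have "S = verts G" using cl by blast
    then show ?thesis using uv S_def by blast
  qed
  show ?thesis
    unfolding conn
  proof (intro conj_cong refl iffI allI impI ballI)
    fix S
    assume "\<forall>u\<in>verts G. \<forall>v\<in>verts G. (u, v) \<in> rtrancl_on (verts G) ?E"
      "S \<subseteq> verts G" "S \<noteq> {}" "\<forall>a\<in>arcs G. tail G a \<in> S \<longleftrightarrow> head G a \<in> S"
    then show "S = verts G" by (rule closed)
  next
    fix u v
    assume "\<forall>S\<subseteq>verts G. S \<noteq> {} \<longrightarrow> (\<forall>a\<in>arcs G. tail G a \<in> S \<longleftrightarrow> head G a \<in> S) \<longrightarrow> S = verts G"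
      "u \<in> verts G" "v \<in> verts G"
    then show "(u, v) \<in> rtrancl_on (verts G) ?E" by (rule reach)
  qed
qed

section \<open>Vertices, edges and connectedness in terms of darts\<close>

locale dart_map =
  fixes M :: "('a, 'm) cmap_scheme"
  assumes map: "is_map M"
begin

abbreviation D where "D \<equiv> darts M"
abbreviation \<theta> where "\<theta> \<equiv> theta M"
abbreviation \<sigma> where "\<sigma> \<equiv> sigma M"
abbreviation vx where "vx \<equiv> vertex_of M"

lemma fin: "finite D" and sigma_perm: "\<sigma> permutes D" and theta_perm: "\<theta> permutes D"
  and theta_neq: "d \<in> D \<Longrightarrow> \<theta> d \<noteq> d"
  and graph_connected: "connected (underlying_graph M)"
  using map by (auto simp: is_map_def)

lemma theta_theta [simp]: "\<theta> (\<theta> d) = d"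
  using map theta_perm by (cases "d \<in> D") (auto simp: is_map_def permutes_not_in)

lemma theta_in [simp]: "\<theta> d \<in> D \<longleftrightarrow> d \<in> D" and sigma_in [simp]: "\<sigma> d \<in> D \<longleftrightarrow> d \<in> D"
  using permutes_in_image[OF theta_perm] permutes_in_image[OF sigma_perm] by auto

lemma sigma_inv [simp]: "\<sigma> (inv \<sigma> d) = d" "inv \<sigma> (\<sigma> d) = d"
  using permutes_inverses[OF sigma_perm] by auto

lemma sigma_inv_in [simp]: "inv \<sigma> d \<in> D \<longleftrightarrow> d \<in> D"
  using sigma_in[of "inv \<sigma> d"] by simp

lemma sigma_eq_iff [simp]: "\<sigma> d = \<sigma> e \<longleftrightarrow> d = e" and theta_eq_iff [simp]: "\<theta> d = \<theta> e \<longleftrightarrow> d = e"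
  by (metis sigma_inv(2), metis theta_theta)

lemma face_next_sigma [simp]: "face_next M (\<theta> (\<sigma> d)) = d"
  by (simp add: face_next_def)

lemma face_next_perm: "face_next M permutes D"
proof -
  have "face_next M = inv \<sigma> \<circ> \<theta>" by (auto simp: face_next_def)
  then show ?thesis using permutes_compose[OF theta_perm permutes_inv[OF sigma_perm]] by simp
qed

lemma face_next_in [simp]: "face_next M d \<in> D \<longleftrightarrow> d \<in> D"
  by (rule permutes_in_image[OF face_next_perm])

lemma self_in_vx [simp]: "d \<in> vx d"
  unfolding vertex_of_def by (rule self_in_orbit_permutes[OF fin sigma_perm])

lemma vx_eq: "e \<in> vx d \<Longrightarrow> vx e = vx d"
  unfolding vertex_of_def by (rule orbit_eq_permutes[OF fin sigma_perm])

lemma vx_sigma [simp]: "vx (\<sigma> d) = vx d"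
  by (rule vx_eq) (simp add: vertex_of_def orbit.base)

lemma vx_sigma_inv [simp]: "vx (inv \<sigma> d) = vx d"
  using vx_sigma[of "inv \<sigma> d"] by simp

lemma vx_face_next [simp]: "vx (face_next M d) = vx (\<theta> d)"
  by (simp add: face_next_def)

lemma vx_eq_iff: "vx e = vx d \<longleftrightarrow> e \<in> vx d"
  using vx_eq self_in_vx by metis

lemma sigma_in_vx [simp]: "\<sigma> e \<in> vx d \<longleftrightarrow> e \<in> vx d"
  unfolding vx_eq_iff[symmetric] by simp

lemma sigma_inv_in_vx [simp]: "inv \<sigma> e \<in> vx d \<longleftrightarrow> e \<in> vx d"
  unfolding vx_eq_iff[symmetric] by simp

lemma vx_subset: "d \<in> D \<Longrightarrow> vx d \<subseteq> D"
  unfolding vertex_of_def by (rule permutes_orbit_subset[OF sigma_perm])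

lemma in_vertex_eq: "v \<in> vertices M \<Longrightarrow> d \<in> v \<Longrightarrow> v = vx d"
  unfolding vertices_def using vx_eq by auto

lemma vertex_subset: "v \<in> vertices M \<Longrightarrow> v \<subseteq> D"
  unfolding vertices_def using vx_subset by auto

lemma vx_in_vertices [simp]: "d \<in> D \<Longrightarrow> vx d \<in> vertices M"
  unfolding vertices_def by simp

lemma vertex_nonempty: "v \<in> vertices M \<Longrightarrow> v \<noteq> {}"
  unfolding vertices_def using self_in_vx by blast

lemma in_vx_iff: "e \<in> vx d \<longleftrightarrow> (\<exists>n. e = (\<sigma> ^^ n) d)"
  unfolding vertex_of_def using orbit_permutes_iff[OF fin sigma_perm] .

lemma vx_closed:
  assumes "d \<in> S" "e \<in> vx d" "\<And>x. x \<in> S \<Longrightarrow> \<sigma> x \<in> S"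
  shows "e \<in> S"
proof -
  have "(\<sigma> ^^ n) d \<in> S" for n by (induction n) (auto simp: assms)
  then show ?thesis using assms(2) in_vx_iff by auto
qed

lemma finite_vertices: "finite (vertices M)"
  unfolding vertices_def using fin by simp

lemma vertices_partition:
  "\<Union>(vertices M) = D" "pairwise disjnt (vertices M)" "{} \<notin> vertices M"
proof -
  have "vertices M = orbit \<sigma> ` D" by (auto simp: vertices_def vertex_of_def)
  then show "\<Union>(vertices M) = D" "pairwise disjnt (vertices M)" "{} \<notin> vertices M"
    using orbits_partition[OF fin sigma_perm] by auto
qed

lemma edges_eq_orbits: "edges M = orbit \<theta> ` D"
proof -
  have "orbit \<theta> d = {d, \<theta> d}" for d
  proof
    show "orbit \<theta> d \<subseteq> {d, \<theta> d}"
    proof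
      fix x assume "x \<in> orbit \<theta> d"
      then show "x \<in> {d, \<theta> d}" by (induction rule: orbit.induct) auto
    qed
    show "{d, \<theta> d} \<subseteq> orbit \<theta> d"
      using orbit.base[of \<theta> d] orbit.step[OF orbit.base, of \<theta> d] by simp
  qed
  then show ?thesis by (simp add: edges_def)
qed

lemma card_darts_edges: "card D = 2 * card (edges M)"
proof -
  have "\<Union>(edges M) = D" "pairwise disjnt (edges M)"
    using orbits_partition[OF fin theta_perm] edges_eq_orbits by auto
  moreover have "finite X \<and> card X = 2" if X: "X \<in> edges M" for X
  proof -
    obtain d where "d \<in> D" "X = {d, \<theta> d}" using X by (auto simp: edges_def)
    then show ?thesis using theta_neq[of d] by auto
  qed
  ultimately show ?thesis
    using card_Union_disjoint[of "edges M"] by simp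
qed

text \<open>Transitivity of the group generated by \<open>\<theta>\<close> and
  \<open>\<sigma>\<close>. It works as an induction over the map: \<open>S\<close> is taken to be
  the set of darts at which a property holds.\<close>

lemma darts_connected:
  assumes "S \<subseteq> D" "S \<noteq> {}" "\<And>d. d \<in> S \<Longrightarrow> \<theta> d \<in> S" "\<And>d. d \<in> S \<Longrightarrow> \<sigma> d \<in> S"
  shows "S = D"
proof -
  let ?G = "underlying_graph M"
  have in_iff: "vx d \<in> vx ` S \<longleftrightarrow> d \<in> S" for d
  proof
    assume "vx d \<in> vx ` S"
    then obtain e where e: "e \<in> S" "vx d = vx e" by blast
    then have "d \<in> vx e" using self_in_vx[of d] by simp
    from vx_closed[OF e(1) this assms(4)] show "d \<in> S" .
  qed simp
  have "vx ` S = verts ?G"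
  proof -
    have "vx ` S \<subseteq> verts ?G" "vx ` S \<noteq> {}"
      using assms(1,2) by (auto simp: underlying_graph_def vertices_def)
    moreover have "\<forall>a\<in>arcs ?G. tail ?G a \<in> vx ` S \<longleftrightarrow> head ?G a \<in> vx ` S"
    proof
      fix a assume "a \<in> arcs ?G"
      have "a \<in> S \<longleftrightarrow> \<theta> a \<in> S" using assms(3)[of a] assms(3)[of "\<theta> a"] by auto
      then show "tail ?G a \<in> vx ` S \<longleftrightarrow> head ?G a \<in> vx ` S"
        by (simp add: underlying_graph_def in_iff)
    qed
    moreover have "connected ?G \<longleftrightarrow> verts ?G \<noteq> {} \<and>
        (\<forall>S\<subseteq>verts ?G. S \<noteq> {} \<longrightarrow>
          (\<forall>a\<in>arcs ?G. tail ?G a \<in> S \<longleftrightarrow> head ?G a \<in> S) \<longrightarrow> S = verts ?G)"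
      by (rule connected_iff_no_closed_set) (auto simp: underlying_graph_def)
    ultimately show ?thesis using graph_connected by blast
  qed
  then have "vx d \<in> vx ` S" if "d \<in> D" for d
    using that by (simp add: underlying_graph_def)
  then show ?thesis using assms(1) in_iff by auto
qed

end

section \<open>Boundaries of sets of faces\<close>

context dart_map
begin

text \<open>Chains modulo 2, all encoded by darts: \<open>face_sets\<close> are the 2-chains,
  \<open>bd\<close> is their boundary map, \<open>odd_vertices\<close> is the boundary map of
  1-chains, and \<open>even_sets\<close> is its kernel, the cycle space.\<close>

definition face_sets :: "'a set set" where
  "face_sets = {A. A \<subseteq> D \<and> face_next M ` A \<subseteq> A}"

definition bd :: "'a set \<Rightarrow> 'a set" where
  "bd A = {d \<in> D. (d \<in> A) \<noteq> (\<theta> d \<in> A)}"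

definition even_sets :: "'a set set" where
  "even_sets = {Z. Z \<subseteq> D \<and> \<theta> ` Z \<subseteq> Z \<and> (\<forall>v\<in>vertices M. even (card (v \<inter> Z)))}"

definition odd_vertices :: "'a set \<Rightarrow> 'a set set" where
  "odd_vertices Z = {v \<in> vertices M. odd (card (v \<inter> Z))}"

lemma face_set_iff:
  assumes "A \<in> face_sets"
  shows "face_next M d \<in> A \<longleftrightarrow> d \<in> A"
  using assms by (intro permutes_closed_iff[OF fin face_next_perm]) (auto simp: face_sets_def)

text \<open>The darts \<open>\<theta> d\<close> and \<open>inv \<sigma> d\<close> are consecutive on
  one face, the face to the right of \<open>d\<close>. So the two sides of an edge can be compared
  within the rotation at a vertex.\<close>

lemma face_set_theta_iff:
  assumes "A \<in> face_sets"
  shows "\<theta> d \<in> A \<longleftrightarrow> inv \<sigma> d \<in> A"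
  using face_set_iff[OF assms, of "\<theta> d"] by (simp add: face_next_def)

lemma bd_eq_sigma:
  assumes "A \<in> face_sets"
  shows "bd A = {d \<in> D. (d \<in> A) \<noteq> (inv \<sigma> d \<in> A)}"
  using face_set_theta_iff[OF assms] by (auto simp: bd_def)

lemma bd_subset: "bd A \<subseteq> D"
  by (auto simp: bd_def)

lemma theta_in_bd [simp]: "\<theta> d \<in> bd A \<longleftrightarrow> d \<in> bd A"
  by (auto simp: bd_def)

lemma vertex_finite: "v \<in> vertices M \<Longrightarrow> finite v"
  using vertex_subset fin finite_subset by blast

text \<open>Boundary darts are the places where membership in \<open>A\<close> changes along the
  rotation, and around a cycle it changes an even number of times. Formally, they form the symmetric
  difference of \<open>v \<inter> A\<close> and its image under one rotation step, two sets of equal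
  size.\<close>

lemma bd_even:
  assumes "A \<in> face_sets"
  shows "bd A \<in> even_sets"
proof -
  have "even (card (v \<inter> bd A))" if v: "v \<in> vertices M" for v
  proof -
    have fv: "finite v" using vertex_finite[OF v] .
    have sv: "\<sigma> x \<in> v \<longleftrightarrow> x \<in> v" for x
    proof -
      have "\<sigma> x \<in> v" if "x \<in> v" for x
        using in_vertex_eq[OF v that] by (simp add: vertex_of_def orbit.base)
      then show ?thesis
        using permutes_closed_iff[OF fin sigma_perm vertex_subset[OF v]] by blast
    qed
    have "v \<inter> bd A = sym_diff (v \<inter> A) (\<sigma> ` (v \<inter> A))"
    proof -
      have "inv \<sigma> d \<in> A \<longleftrightarrow> d \<in> \<sigma> ` (v \<inter> A)" if "d \<in> v" for d
        using that sv[of "inv \<sigma> d"] by (metis IntD2 IntI image_iff sigma_inv)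
      moreover have "d \<in> v" if "d \<in> \<sigma> ` (v \<inter> A)" for d
        using that sv by auto
      ultimately show ?thesis
        using vertex_subset[OF v] unfolding bd_eq_sigma[OF assms] by blast
    qed
    moreover have "card (\<sigma> ` (v \<inter> A)) = card (v \<inter> A)"
      by (intro card_image inj_onI) simp
    ultimately show ?thesis using even_card_sym_diff[of "v \<inter> A" "\<sigma> ` (v \<inter> A)"] fv by simp
  qed
  moreover have "\<theta> ` bd A \<subseteq> bd A" by auto
  ultimately show ?thesis using bd_subset by (simp add: even_sets_def)
qed

lemma sym_diff_face_sets:
  assumes "A \<in> face_sets" "B \<in> face_sets"
  shows "sym_diff A B \<in> face_sets"
proof -
  have "face_next M ` sym_diff A B \<subseteq> sym_diff A B"
    using face_set_iff[OF assms(1)] face_set_iff[OF assms(2)] by auto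
  then show ?thesis using assms by (auto simp: face_sets_def)
qed

lemma bd_sym_diff: "bd (sym_diff A B) = sym_diff (bd A) (bd B)"
  by (auto simp: bd_def)

lemma bd_empty:
  assumes "A \<in> face_sets" "bd A = {}" "A \<noteq> {}"
  shows "A = D"
proof (rule darts_connected)
  show AD: "A \<subseteq> D" using assms(1) by (simp add: face_sets_def)
  show th: "\<theta> d \<in> A" if "d \<in> A" for d
    using that assms(2) AD by (auto simp: bd_def)
  show "\<sigma> d \<in> A" if "d \<in> A" for d
    using face_set_theta_iff[OF assms(1), of "\<sigma> d"] that th[of "\<theta> (\<sigma> d)"] by simp
qed fact

text \<open>By connectedness the kernel of \<open>bd\<close> consists of the empty set and
  \<open>D\<close> only.\<close>

lemma bd_eq_cases:
  assumes "A \<in> face_sets" "B \<in> face_sets" "bd A = bd B"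
  shows "B = A \<or> B = D - A"
proof -
  have "bd (sym_diff A B) = {}" using assms(3) bd_sym_diff by simp
  then have "sym_diff A B = {} \<or> sym_diff A B = D"
    using bd_empty[OF sym_diff_face_sets[OF assms(1,2)]] by blast
  moreover have "A \<subseteq> D" "B \<subseteq> D" using assms(1,2) by (auto simp: face_sets_def)
  ultimately show ?thesis by blast
qed

lemma D_nonempty: "D \<noteq> {}"
  using graph_connected
  by (auto simp: connected_def strongly_connected_def underlying_graph_def vertices_def)

lemma finite_subsets: "(\<And>A. A \<in> X \<Longrightarrow> A \<subseteq> D) \<Longrightarrow> finite X"
  using fin by (meson PowI finite_Pow_iff finite_subset subsetI)

lemma card_face_sets_le: "card face_sets \<le> 2 * card (bd ` face_sets)"
proof -
  obtain d0 where d0: "d0 \<in> D" using D_nonempty by blast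
  \<comment> \<open>The membership of one base dart distinguishes a set from its complement.\<close>
  have "inj_on (\<lambda>A. (bd A, d0 \<in> A)) face_sets"
  proof (rule inj_onI)
    fix A B assume "A \<in> face_sets" "B \<in> face_sets" "(bd A, d0 \<in> A) = (bd B, d0 \<in> B)"
    then show "A = B" using bd_eq_cases[of A B] d0 by auto
  qed
  moreover have "(\<lambda>A. (bd A, d0 \<in> A)) ` face_sets \<subseteq> bd ` face_sets \<times> UNIV" by auto
  moreover have "finite (bd ` face_sets \<times> (UNIV :: bool set))"
    by (intro finite_cartesian_product finite_imageI finite_subsets) (auto simp: face_sets_def)
  ultimately have "card face_sets \<le> card (bd ` face_sets \<times> (UNIV :: bool set))"
    using card_inj_on_le by blast
  then show ?thesis by (simp add: card_cartesian_product mult.commute)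
qed

section \<open>The size of the cycle space\<close>

definition edge_sets :: "'a set set" where
  "edge_sets = {Z. Z \<subseteq> D \<and> \<theta> ` Z \<subseteq> Z}"

lemma odd_vertices_sym_diff:
  "odd_vertices (sym_diff Y Z) = sym_diff (odd_vertices Y) (odd_vertices Z)"
proof -
  have "odd (card (v \<inter> sym_diff Y Z)) \<longleftrightarrow> odd (card (v \<inter> Y)) \<noteq> odd (card (v \<inter> Z))"
    if "v \<in> vertices M" for v
  proof -
    have "v \<inter> sym_diff Y Z = sym_diff (v \<inter> Y) (v \<inter> Z)" by blast
    then show ?thesis using even_card_sym_diff[of "v \<inter> Y" "v \<inter> Z"] vertex_finite[OF that] by auto
  qed
  then show ?thesis unfolding odd_vertices_def by blast
qed

lemma sym_diff_edge_sets:
  assumes "Y \<in> edge_sets" "Z \<in> edge_sets"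
  shows "sym_diff Y Z \<in> edge_sets"
proof -
  have "\<theta> x \<in> Y \<longleftrightarrow> x \<in> Y" "\<theta> x \<in> Z \<longleftrightarrow> x \<in> Z" for x
    using assms permutes_closed_iff[OF fin theta_perm] by (auto simp: edge_sets_def)
  then have "\<theta> ` sym_diff Y Z \<subseteq> sym_diff Y Z" by auto
  then show ?thesis using assms by (auto simp: edge_sets_def)
qed

lemma even_sets_eq: "even_sets = {Z \<in> edge_sets. odd_vertices Z = {}}"
  by (auto simp: even_sets_def edge_sets_def odd_vertices_def)

lemma odd_vertices_edge:
  assumes "d \<in> D"
  shows "odd_vertices {d, \<theta> d} = sym_diff {vx d} {vx (\<theta> d)}"
proof -
  have odd: "odd (card (v \<inter> {d, \<theta> d})) \<longleftrightarrow> v \<in> sym_diff {vx d} {vx (\<theta> d)}"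
    if v: "v \<in> vertices M" for v
  proof -
    have "d \<in> v \<longleftrightarrow> v = vx d" "\<theta> d \<in> v \<longleftrightarrow> v = vx (\<theta> d)"
      using in_vertex_eq[OF v, of d] in_vertex_eq[OF v, of "\<theta> d"] self_in_vx[of d] self_in_vx[of "\<theta> d"]
      by blast+
    then show ?thesis
      using theta_neq[OF assms] by (cases "v = vx d"; cases "v = vx (\<theta> d)") (simp_all add: Int_insert_right)
  qed
  show ?thesis
  proof (rule set_eqI)
    fix v
    show "v \<in> odd_vertices {d, \<theta> d} \<longleftrightarrow> v \<in> sym_diff {vx d} {vx (\<theta> d)}"
    proof (cases "v \<in> vertices M")
      case True
      then show ?thesis using odd[OF True] unfolding odd_vertices_def by blast
    next
      case False
      then have "v \<noteq> vx d" "v \<noteq> vx (\<theta> d)" using assms by auto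
      then show ?thesis using False unfolding odd_vertices_def by blast
    qed
  qed
qed

text \<open>\<open>Z\<close> consists of the edges, modulo 2, of a walk between the two vertices:
  passing from \<open>d\<close> to \<open>\<theta> d\<close> adds one edge and moves the end of the
  walk, and rotating changes nothing.\<close>

lemma odd_vertices_path:
  assumes "d0 \<in> D" "d \<in> D"
  shows "\<exists>Z\<in>edge_sets. odd_vertices Z = sym_diff {vx d} {vx d0}"
proof -
  define S where "S = {d \<in> D. \<exists>Z\<in>edge_sets. odd_vertices Z = sym_diff {vx d} {vx d0}}"
  have "S = D"
  proof (rule darts_connected)
    have "odd_vertices {} = {}" by (simp add: odd_vertices_def)
    then have "d0 \<in> S" using assms(1) by (auto simp: S_def edge_sets_def)
    then show "S \<noteq> {}" by blast
    show "\<theta> d \<in> S" if d: "d \<in> S" for d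
    proof -
      obtain Z where Z: "Z \<in> edge_sets" "odd_vertices Z = sym_diff {vx d} {vx d0}"
        using d by (auto simp: S_def)
      have dD: "d \<in> D" using d by (simp add: S_def)
      then have "{d, \<theta> d} \<in> edge_sets" by (auto simp: edge_sets_def)
      then have "sym_diff Z {d, \<theta> d} \<in> edge_sets" using Z(1) by (intro sym_diff_edge_sets)
      moreover have "odd_vertices (sym_diff Z {d, \<theta> d}) = sym_diff {vx (\<theta> d)} {vx d0}"
        unfolding odd_vertices_sym_diff Z(2) odd_vertices_edge[OF dD] by blast
      ultimately show ?thesis using dD unfolding S_def by auto
    qed
  qed (auto simp: S_def)
  then show ?thesis using assms(2) by (auto simp: S_def)
qed

text \<open>The rank of \<open>odd_vertices\<close> is at least V-1. Parity at a root vertex is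
  ignored, and a walk from the root to \<open>w\<close> toggles the parity at \<open>w\<close> alone
  among the other vertices.\<close>

lemma card_odd_vertices_ge: "2 ^ (card (vertices M) - 1) \<le> card (odd_vertices ` edge_sets)"
proof -
  obtain d0 where d0: "d0 \<in> D" using D_nonempty by blast
  let ?r = "vx d0"
  have ex: "\<exists>Z\<in>edge_sets. odd_vertices Z - {?r} = W" if "W \<subseteq> vertices M - {?r}" for W
  proof -
    have "finite W" using that finite_vertices finite_subset by blast
    then show ?thesis using that
    proof (induction W rule: finite_induct)
      case empty
      have "odd_vertices {} = {}" by (simp add: odd_vertices_def)
      then show ?case by (intro bexI[of _ "{}"]) (auto simp: edge_sets_def)
    next
      case (insert w W)
      then obtain Z where Z: "Z \<in> edge_sets" "odd_vertices Z - {?r} = W" by auto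
      obtain d where d: "d \<in> D" "w = vx d" using insert.prems by (auto simp: vertices_def)
      obtain Y where Y: "Y \<in> edge_sets" "odd_vertices Y = sym_diff {w} {?r}"
        using odd_vertices_path[OF d0 d(1)] d(2) by auto
      have "odd_vertices (sym_diff Z Y) - {?r} = insert w W"
        unfolding odd_vertices_sym_diff Y(2) using Z(2) insert by blast
      then show ?case using sym_diff_edge_sets[OF Z(1) Y(1)] by blast
    qed
  qed
  have "Pow (vertices M - {?r}) \<subseteq> (\<lambda>W. W - {?r}) ` (odd_vertices ` edge_sets)"
  proof
    fix W assume "W \<in> Pow (vertices M - {?r})"
    then obtain Z where "Z \<in> edge_sets" "odd_vertices Z - {?r} = W" using ex[of W] by auto
    then show "W \<in> (\<lambda>W. W - {?r}) ` (odd_vertices ` edge_sets)" by blast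
  qed
  moreover have fin': "finite (odd_vertices ` edge_sets)"
    by (intro finite_imageI finite_subsets) (auto simp: edge_sets_def)
  ultimately have "card (Pow (vertices M - {?r})) \<le> card ((\<lambda>W. W - {?r}) ` (odd_vertices ` edge_sets))"
    by (intro card_mono finite_imageI[OF fin'])
  also have "\<dots> \<le> card (odd_vertices ` edge_sets)" by (rule card_image_le[OF fin'])
  finally have "card (Pow (vertices M - {?r})) \<le> card (odd_vertices ` edge_sets)" .
  then show ?thesis using finite_vertices d0 by (simp add: card_Pow)
qed

text \<open>Half of the rank-nullity theorem, by counting: each fibre of \<open>odd_vertices\<close>
  contains the translate of the kernel by a chosen representative \<open>c W\<close>.\<close>

lemma card_even_sets: "card even_sets * card (odd_vertices ` edge_sets) \<le> card edge_sets"
proof -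
  define c where "c W = (SOME Z. Z \<in> edge_sets \<and> odd_vertices Z = W)" for W
  have c: "c W \<in> edge_sets" "odd_vertices (c W) = W" if "W \<in> odd_vertices ` edge_sets" for W
    using that someI_ex[of "\<lambda>Z. Z \<in> edge_sets \<and> odd_vertices Z = W"] unfolding c_def by auto
  let ?f = "\<lambda>(Z, W). sym_diff (c W) Z"
  have odd: "odd_vertices (?f (Z, W)) = W"
    if "Z \<in> even_sets" "W \<in> odd_vertices ` edge_sets" for Z W
    using that c[OF that(2)] by (simp add: odd_vertices_sym_diff even_sets_eq)
  have "inj_on ?f (even_sets \<times> odd_vertices ` edge_sets)"
  proof (rule inj_onI)
    fix x y
    assume x: "x \<in> even_sets \<times> odd_vertices ` edge_sets" and y: "y \<in> even_sets \<times> odd_vertices ` edge_sets"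
      and eq: "?f x = ?f y"
    then have "snd x = snd y" using odd[of "fst x" "snd x"] odd[of "fst y" "snd y"] by (auto simp: case_prod_unfold)
    then have "sym_diff (c (snd y)) (fst x) = sym_diff (c (snd y)) (fst y)"
      using eq by (simp add: case_prod_unfold)
    then have "fst x = fst y" by blast
    with \<open>snd x = snd y\<close> show "x = y" by (simp add: prod_eq_iff)
  qed
  moreover have "?f ` (even_sets \<times> odd_vertices ` edge_sets) \<subseteq> edge_sets"
    using c(1) sym_diff_edge_sets by (auto simp: even_sets_eq)
  moreover have "finite edge_sets"
    by (intro finite_subsets) (auto simp: edge_sets_def)
  ultimately have "card (even_sets \<times> odd_vertices ` edge_sets) \<le> card edge_sets"
    by (rule card_inj_on_le)
  then show ?thesis by (simp add: card_cartesian_product)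
qed

text \<open>There are at least 2^(F-1) boundaries, because \<open>bd\<close> has a kernel of order
  2, and at most 2^(E-V+1) even sets. Euler's formula makes the two numbers equal, and boundaries
  are even, so both families coincide.\<close>

theorem even_set_is_bd:
  assumes "plane_map M" "Z \<in> even_sets"
  obtains A where "A \<in> face_sets" "bd A = Z"
proof -
  have finE: "finite even_sets"
    by (intro finite_subsets) (auto simp: even_sets_def)
  define V E F where "V = card (vertices M)" and "E = card (edges M)" and "F = card (faces M)"
  have euler: "int V - int E + int F = 2" using assms(1) by (simp add: plane_map_def V_def E_def F_def)
  have pos: "V > 0" "F > 0"
    using D_nonempty finite_vertices fin by (auto simp: V_def F_def vertices_def faces_def card_gt_0_iff)
  have "card face_sets = 2 ^ F"
    unfolding face_sets_def F_def faces_def by (rule card_closed_sets[OF fin face_next_perm])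
  then have B: "2 ^ (F - 1) \<le> card (bd ` face_sets)"
    using card_face_sets_le pos by (cases F) auto
  have "card edge_sets = 2 ^ E"
    unfolding edge_sets_def E_def edges_eq_orbits by (rule card_closed_sets[OF fin theta_perm])
  then have "card even_sets * 2 ^ (V - 1) \<le> 2 ^ E"
    using card_even_sets mult_le_mono2[OF card_odd_vertices_ge, of "card even_sets"]
    unfolding V_def by linarith
  also have "E = (F - 1) + (V - 1)" using euler pos by linarith
  finally have "card even_sets \<le> 2 ^ (F - 1)" by (simp add: power_add)
  then have "card even_sets \<le> card (bd ` face_sets)" using B by linarith
  moreover have "bd ` face_sets \<subseteq> even_sets" using bd_even by blast
  ultimately have "bd ` face_sets = even_sets"
    using card_seteq[OF finE] by blast
  then obtain A where "A \<in> face_sets" "bd A = Z" using assms(2) by (metis imageE)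
  then show ?thesis by (rule that)
qed

end

section \<open>The reflection of a double\<close>

lemma orbit_subset_3: "f (f (f d)) = d \<Longrightarrow> orbit f d \<subseteq> {d, f d, f (f d)}"
proof
  fix x assume "f (f (f d)) = d" "x \<in> orbit f d"
  from this(2,1) show "x \<in> {d, f d, f (f d)}" by (induction rule: orbit.induct) auto
qed

lemma orbit_3_cycle:
  assumes "finite S" "f permutes S" "card (orbit f d) = 3"
  shows "f (f (f d)) = d" "f d \<noteq> d" "f (f d) \<noteq> d"
proof -
  have eq: "f x = f y \<longleftrightarrow> x = y" for x y using permutes_inj[OF assms(2)] by (simp add: inj_eq)
  have in_orbit: "{d, f d, f (f d)} \<subseteq> orbit f d"
    using self_in_orbit_permutes[OF assms(1,2), of d] orbit.base[of f d]
      orbit.step[OF orbit.base[of f d]] by simp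
  have 1: "f d \<noteq> d"
  proof
    assume "f d = d"
    then have "orbit f d \<subseteq> {d}" using orbit_subset_3[of f d] by simp
    then have "card (orbit f d) \<le> card {d}" by (intro card_mono) auto
    then show False using assms(3) by simp
  qed
  moreover have 2: "f (f d) \<noteq> d"
  proof
    assume 2: "f (f d) = d"
    have "orbit f d \<subseteq> {d, f d}"
    proof
      fix x assume "x \<in> orbit f d"
      then show "x \<in> {d, f d}" by (induction rule: orbit.induct) (use 2 in auto)
    qed
    then have "card (orbit f d) \<le> card {d, f d}" by (intro card_mono) auto
    then show False using assms(3) 1 by simp
  qed
  moreover have "orbit f d = {d, f d, f (f d)}"
  proof -
    have "finite (orbit f d)" using assms(3) by (metis card.infinite numeral_3_eq_3 old.nat.distinct(1))
    then show ?thesis using card_seteq[OF _ in_orbit] assms(3) 1 2 eq[of d "f d"] by auto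
  qed
  moreover have "f (f (f d)) \<in> orbit f d" by (intro orbit.intros)
  ultimately show "f (f (f d)) = d" "f d \<noteq> d" "f (f d) \<noteq> d"
    using eq[of "f d" "f (f d)"] eq[of "f (f d)" d] eq[of d "f d"] eq[of "f (f d)" "f d"] by auto
qed

locale lsp_double =
  fixes L :: "'a lsp_map" and Op :: "'b marked_map" and h
  assumes lsp: "lsp_operation L"
    and lopsp: "lopsp_operation Op"
    and iso: "marked_map_iso h (lopsp_of_lsp L) Op"
begin

sublocale L: dart_map L
  using lsp by unfold_locales (simp add: lsp_operation_def plane_map_def)

sublocale O: dart_map Op
  using lopsp by unfold_locales (simp add: lopsp_operation_def plane_map_def)

abbreviation DD where "DD \<equiv> double_darts L"
abbreviation out where "out \<equiv> outer L"
abbreviation s where "s \<equiv> double_sigma L"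

lemma bij_h: "bij_betw h DD O.D"
  and h_theta: "p \<in> DD \<Longrightarrow> O.\<theta> (h p) = h (double_theta L p)"
  and h_sigma: "p \<in> DD \<Longrightarrow> O.\<sigma> (h p) = h (s p)"
  using iso by (auto simp: marked_map_iso_def lopsp_of_lsp_def)

lemma out_subset: "out \<subseteq> L.D"
  using lsp permutes_orbit_subset[OF L.face_next_perm] by (auto simp: lsp_operation_def faces_def)

lemma out_face_set: "out \<in> L.face_sets"
proof -
  obtain d where "out = orbit (face_next L) d" using lsp by (auto simp: lsp_operation_def faces_def)
  then show ?thesis using out_subset by (auto simp: L.face_sets_def intro: orbit.step)
qed

lemma theta_out_iff: "L.\<theta> d \<in> out \<longleftrightarrow> inv L.\<sigma> d \<in> out"
  by (rule L.face_set_theta_iff[OF out_face_set])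

lemma boundary_iff: "d \<in> boundary_darts L \<longleftrightarrow> d \<in> out \<or> inv L.\<sigma> d \<in> out"
proof -
  have "d \<in> L.\<theta> ` out \<longleftrightarrow> L.\<theta> d \<in> out" using image_eqI[of d L.\<theta> "L.\<theta> d"] by auto
  then show ?thesis using theta_out_iff by (auto simp: boundary_darts_def)
qed

lemma boundary_theta_iff: "L.\<theta> d \<in> boundary_darts L \<longleftrightarrow> d \<in> boundary_darts L"
  using theta_out_iff[of d] theta_out_iff[of "L.\<theta> d"] by (auto simp: boundary_iff)

lemma DD_iff: "(d, b) \<in> DD \<longleftrightarrow> d \<in> L.D \<and> (b \<longrightarrow> d \<notin> boundary_darts L)"
  by (auto simp: double_darts_def)

lemma s_eq:
  assumes "(d, b) \<in> DD"
  shows "s (d, b) = (if \<not> b \<and> d \<notin> out then (L.\<sigma> d, False) else mirror_dart L (inv L.\<sigma> d))"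
  using assms by (simp add: double_sigma_def)

lemma s_in: "p \<in> DD \<Longrightarrow> s p \<in> DD"
  by (cases p) (auto simp: s_eq DD_iff mirror_dart_def)

text \<open>Transported along \<open>h\<close> from the rotation of \<open>Op\<close>. It is the
  source of the information that the outer face is not degenerate.\<close>

lemma s_surj:
  assumes "q \<in> DD"
  obtains p where "p \<in> DD" "s p = q"
proof -
  have "h q \<in> O.D" using bij_h assms bij_betwE by blast
  then have "inv O.\<sigma> (h q) \<in> h ` DD" using bij_h by (simp add: bij_betw_def)
  then obtain p where p: "p \<in> DD" "inv O.\<sigma> (h q) = h p" by auto
  then have "h (s p) = h q" using h_sigma[OF p(1)] by (metis O.sigma_inv(1))
  then have "s p = q" using bij_h s_in[OF p(1)] assms by (auto simp: bij_betw_def dest: inj_onD)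
  then show ?thesis using that p by blast
qed

lemma triangle: "d \<in> O.D \<Longrightarrow> face_next Op (face_next Op (face_next Op d)) = d"
  using lopsp by (intro orbit_3_cycle(1)[OF O.fin O.face_next_perm])
    (auto simp: lopsp_operation_def faces_def)

text \<open>
  An edge with the outer face on both sides would propagate, by surjectivity of the rotation of the
  double, to a map \<open>L\<close> all of whose edges are like this. Its double would be its mirror image, a
  triangulation with a single face, which cannot have an even number of darts.
\<close>

lemma outer_edge_one_sided:
  assumes "d \<in> out"
  shows "inv L.\<sigma> d \<notin> out"
proof
  assume inv: "inv L.\<sigma> d \<in> out"
  define W where "W = {d \<in> out. L.\<theta> d \<in> out}"
  have "W = L.D"
  proof (rule L.darts_connected)
    show "W \<subseteq> L.D" using out_subset by (auto simp: W_def)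
    show "W \<noteq> {}" using assms inv theta_out_iff by (auto simp: W_def)
    show "L.\<theta> d \<in> W" if "d \<in> W" for d using that by (simp add: W_def)
    show "L.\<sigma> d \<in> W" if "d \<in> W" for d
    proof -
      have d: "d \<in> out" "inv L.\<sigma> d \<in> out" "(d, False) \<in> DD"
        using that out_subset theta_out_iff by (auto simp: W_def DD_iff)
      obtain p where p: "p \<in> DD" "s p = (d, False)" using s_surj d(3) by blast
      obtain x b where xb: "p = (x, b)" by fastforce
      \<comment> \<open>Inside the first copy of \<open>L\<close>, the dart \<open>d\<close> could
        only be reached from \<open>inv L.\<sigma> d\<close>, which is an outer dart. So the
        preimage comes from the mirrored branch and lies over \<open>L.\<sigma> d\<close>.\<close>
      have "\<not> (\<not> b \<and> x \<notin> out)" using p d(2) xb s_eq[of x b] by (auto split: if_splits)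
      then have "inv L.\<sigma> x = d" using p xb s_eq[of x b] by (auto simp: mirror_dart_def split: if_splits)
      then have x: "x = L.\<sigma> d" by auto
      then have "x \<in> boundary_darts L" using d(1) by (simp add: boundary_iff)
      then have "x \<in> out" using \<open>\<not> (\<not> b \<and> x \<notin> out)\<close> p(1) xb by (auto simp: DD_iff)
      then show ?thesis using x d(1) theta_out_iff[of "L.\<sigma> d"] by (simp add: W_def)
    qed
  qed
  then have out: "out = L.D" using out_subset by (auto simp: W_def)
  have h_out: "O.\<theta> (h (d, False)) = h (L.\<theta> d, False)" "O.\<sigma> (h (d, False)) = h (inv L.\<sigma> d, False)"
    if "d \<in> L.D" for d
  proof -
    have "(d, False) \<in> DD" using that by (simp add: DD_iff)
    then show "O.\<theta> (h (d, False)) = h (L.\<theta> d, False)" "O.\<sigma> (h (d, False)) = h (inv L.\<sigma> d, False)"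
      using h_theta h_sigma that s_eq[of d False]
      by (auto simp: out double_theta_def mirror_dart_def boundary_iff)
  qed
  have h_next: "face_next Op (h (d, False)) = h (L.\<sigma> (L.\<theta> d), False)" if "d \<in> L.D" for d
  proof -
    have "O.\<sigma> (h (L.\<sigma> (L.\<theta> d), False)) = O.\<theta> (h (d, False))" using h_out that by simp
    then show ?thesis unfolding face_next_def by (metis O.sigma_inv(2))
  qed
  let ?k = "\<lambda>d. L.\<sigma> (L.\<theta> d)"
  have k3: "?k (?k (?k d)) = d" if "d \<in> L.D" for d
  proof -
    have "(x, False) \<in> DD" if "x \<in> L.D" for x using that by (simp add: DD_iff)
    moreover have "h (?k (?k (?k d)), False) = h (d, False)"
      using triangle[of "h (d, False)"] h_next that calculation[OF that] bij_h
      by (auto simp: bij_betw_def)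
    ultimately show ?thesis using bij_h that by (auto simp: bij_betw_def dest!: inj_onD)
  qed
  \<comment> \<open>\<open>?k\<close> is the face permutation of the mirror image. Up to conjugation
    by \<open>\<theta>\<close> it is inverse to that of \<open>L\<close>, so triangles in the mirror
    image yield triangles in \<open>L\<close>.\<close>
  have k_next: "?k (L.\<theta> (face_next L d)) = L.\<theta> d" for d by (simp add: face_next_def)
  have "face_next L (face_next L (face_next L d)) = d" if "d \<in> L.D" for d
  proof -
    let ?e = "face_next L (face_next L (face_next L d))"
    have "?k (?k (?k (L.\<theta> ?e))) = L.\<theta> d" by (simp only: k_next)
    then show ?thesis using k3[of "L.\<theta> ?e"] that by simp
  qed
  moreover obtain d0 where d0: "d0 \<in> L.D" "out = orbit (face_next L) d0"
    using lsp by (auto simp: lsp_operation_def faces_def)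
  ultimately have sub: "L.D \<subseteq> {d0, face_next L d0, face_next L (face_next L d0)}"
    using orbit_subset_3[of "face_next L" d0] out by simp
  have "card L.D \<le> card {d0, face_next L d0, face_next L (face_next L d0)}"
    by (rule card_mono[OF _ sub]) simp
  also have "\<dots> \<le> 3" by (auto simp: card_insert_if)
  finally have "card L.D \<le> 3" .
  moreover have "3 \<le> card (vertices L)" using lsp by (simp add: lsp_operation_def two_connected_def)
  moreover have "card (vertices L) \<le> card L.D" unfolding vertices_def by (rule card_image_le[OF L.fin])
  ultimately have "card L.D = 3" by simp
  then show False using L.card_darts_edges by presburger
qed

definition mir :: "'a \<times> bool \<Rightarrow> 'a \<times> bool" where
  "mir p = (if snd p then (fst p, False) else mirror_dart L (fst p))"

lemma mir_simps: "mir (d, True) = (d, False)" "mir (d, False) = mirror_dart L d"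
  "mir (mirror_dart L d) = (d, False)"
  by (auto simp: mir_def mirror_dart_def)

lemma mir_in: "p \<in> DD \<Longrightarrow> mir p \<in> DD"
  by (cases p) (auto simp: mir_def mirror_dart_def DD_iff)

lemma mir_mir: "p \<in> DD \<Longrightarrow> mir (mir p) = p"
  by (cases p) (auto simp: mir_def mirror_dart_def DD_iff)

lemma mir_theta: "p \<in> DD \<Longrightarrow> double_theta L (mir p) = mir (double_theta L p)"
  by (cases p) (auto simp: mir_def mirror_dart_def double_theta_def DD_iff boundary_theta_iff)

text \<open>This expresses that \<open>mir\<close> conjugates the rotation to its inverse, in a form
  without an inverse of \<open>s\<close>, so that both sides can be evaluated by cases.\<close>

lemma s_mir_s:
  assumes "p \<in> DD"
  shows "s (mir (s p)) = mir p"
proof -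
  obtain d b where p: "p = (d, b)" by fastforce
  have d: "d \<in> L.D" using assms p by (simp add: DD_iff)
  show ?thesis
  proof (cases "\<not> b \<and> d \<notin> out")
    case True
    then have sp: "s p = (L.\<sigma> d, False)" using assms p by (simp add: s_eq)
    show ?thesis
    proof (cases "L.\<sigma> d \<in> out")
      case out: True
      then have m: "mirror_dart L (L.\<sigma> d) = (L.\<sigma> d, False)" by (simp add: mirror_dart_def boundary_iff)
      have "s (L.\<sigma> d, False) = mirror_dart L d" using out d by (simp add: s_eq DD_iff)
      then show ?thesis using sp p True by (simp add: mir_simps m)
    next
      case out: False
      then have bd: "L.\<sigma> d \<notin> boundary_darts L" using True by (simp add: boundary_iff)
      then have m: "mirror_dart L (L.\<sigma> d) = (L.\<sigma> d, True)" by (simp add: mirror_dart_def)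
      have "s (L.\<sigma> d, True) = mirror_dart L d" using bd d by (simp add: s_eq DD_iff)
      then show ?thesis using sp p True by (simp add: mir_simps m)
    qed
  next
    case False
    then have sp: "s p = mirror_dart L (inv L.\<sigma> d)" using assms p by (auto simp: s_eq)
    \<comment> \<open>An outer \<open>d\<close> does not have the outer face on its other side, and
      a dart of the mirrored copy is no boundary dart. Hence the rotation goes back from
      \<open>inv L.\<sigma> d\<close> inside \<open>L\<close>.\<close>
    have "inv L.\<sigma> d \<notin> out"
      using False outer_edge_one_sided[of d] assms p by (auto simp: DD_iff boundary_iff)
    then have "s (inv L.\<sigma> d, False) = (d, False)" using d by (simp add: s_eq DD_iff)
    moreover have "mir p = (d, False)"
      using False p by (auto simp: mir_def mirror_dart_def boundary_iff)
    ultimately show ?thesis using sp by (simp add: mir_simps)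
  qed
qed

lemma reflection_exists:
  "\<exists>\<phi>. orientation_reversing_automorphism Op \<phi> \<and>
     fixes_vertex \<phi> (v0 Op) \<and> fixes_vertex \<phi> (v1 Op) \<and> fixes_vertex \<phi> (v2 Op)"
proof -
  define \<phi> where "\<phi> x = h (mir (inv_into DD h x))" for x
  have \<phi>_h: "\<phi> (h p) = h (mir p)" if "p \<in> DD" for p
    using bij_h that by (simp add: \<phi>_def bij_betw_def)
  have ex: "\<exists>p\<in>DD. x = h p" if "x \<in> O.D" for x
    using bij_h that by (auto simp: bij_betw_def)
  have D_h: "h p \<in> O.D" if "p \<in> DD" for p
    using bij_h that by (auto simp: bij_betw_def)
  have \<phi>\<phi>: "\<phi> (\<phi> x) = x \<and> \<phi> x \<in> O.D" if "x \<in> O.D" for x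
    using ex[OF that] by (auto simp: \<phi>_h mir_in mir_mir D_h)
  then have bij: "bij_betw \<phi> O.D O.D" by (intro bij_betw_byWitness[of _ \<phi>]) auto
  have comm: "O.\<theta> (\<phi> x) = \<phi> (O.\<theta> x) \<and> inv O.\<sigma> (\<phi> x) = \<phi> (O.\<sigma> x)" if "x \<in> O.D" for x
  proof -
    obtain p where p: "p \<in> DD" "x = h p" using ex \<open>x \<in> O.D\<close> by blast
    have "double_theta L p \<in> DD" using p(1)
      by (cases p) (auto simp: double_theta_def DD_iff boundary_theta_iff)
    then have "O.\<theta> (\<phi> x) = \<phi> (O.\<theta> x)"
      using p by (simp add: \<phi>_h h_theta mir_in mir_theta)
    moreover have "O.\<sigma> (\<phi> (O.\<sigma> x)) = \<phi> x"
      using p by (simp add: \<phi>_h h_sigma mir_in s_in s_mir_s)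
    ultimately show ?thesis by (metis O.sigma_inv(2))
  qed
  \<comment> \<open>The marked vertices of the double are given by a condition on the first
    component, which \<open>mir\<close> never changes.\<close>
  have fixed: "fixes_vertex \<phi> (h ` {p \<in> DD. fst p \<in> v})" for v
    unfolding fixes_vertex_def
  proof (intro image_subsetI)
    fix x assume "x \<in> h ` {p \<in> DD. fst p \<in> v}"
    then obtain p where p: "p \<in> DD" "fst p \<in> v" "x = h p" by auto
    then have "fst (mir p) \<in> v" by (simp add: mir_def mirror_dart_def)
    then show "\<phi> x \<in> h ` {p \<in> DD. fst p \<in> v}" using p by (simp add: \<phi>_h mir_in)
  qed
  have vs: "v0 Op = h ` {p \<in> DD. fst p \<in> v0 L}" "v1 Op = h ` {p \<in> DD. fst p \<in> v1 L}"
    "v2 Op = h ` {p \<in> DD. fst p \<in> v2 L}"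
    using iso by (simp_all add: marked_map_iso_def lopsp_of_lsp_def)
  have "fixes_vertex \<phi> (v0 Op)" "fixes_vertex \<phi> (v1 Op)" "fixes_vertex \<phi> (v2 Op)"
    unfolding vs by (rule fixed)+
  with bij comm show ?thesis unfolding orientation_reversing_automorphism_def by blast
qed

end

section \<open>Reflections preserve colours\<close>

locale lopsp_reflection =
  fixes Op :: "'a marked_map" and \<phi> :: "'a \<Rightarrow> 'a"
  assumes lopsp: "lopsp_operation Op"
    and reversing: "orientation_reversing_automorphism Op \<phi>"
    and fixes_marked: "fixes_vertex \<phi> (v0 Op)" "fixes_vertex \<phi> (v1 Op)" "fixes_vertex \<phi> (v2 Op)"
begin

sublocale dart_map Op
  using lopsp by unfold_locales (simp add: lopsp_operation_def plane_map_def)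

abbreviation fn where "fn \<equiv> face_next Op"
abbreviation col where "col d \<equiv> colour Op (vx d)"

section \<open>The reflection is an involution\<close>

lemma marked_in: "v0 Op \<in> vertices Op" "v1 Op \<in> vertices Op" "v2 Op \<in> vertices Op"
  and marked_distinct: "distinct [v0 Op, v1 Op, v2 Op]"
  using lopsp by (auto simp: lopsp_operation_def coloured_and_marked_def)

lemma phi_in: "d \<in> D \<Longrightarrow> \<phi> d \<in> D"
  and phi_theta: "d \<in> D \<Longrightarrow> \<phi> (\<theta> d) = \<theta> (\<phi> d)"
  and phi_sigma: "d \<in> D \<Longrightarrow> \<phi> (\<sigma> d) = inv \<sigma> (\<phi> d)"
  using reversing by (auto simp: orientation_reversing_automorphism_def bij_betw_def)

lemma phi_sigma_inv: "d \<in> D \<Longrightarrow> \<phi> (inv \<sigma> d) = \<sigma> (\<phi> d)"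
  using phi_sigma[of "inv \<sigma> d"] by simp

lemma phi_inj: "d \<in> D \<Longrightarrow> e \<in> D \<Longrightarrow> \<phi> d = \<phi> e \<longleftrightarrow> d = e"
  using reversing by (auto simp: orientation_reversing_automorphism_def bij_betw_def dest: inj_onD)

lemma sigma_funpow_in: "d \<in> D \<Longrightarrow> (\<sigma> ^^ n) d \<in> D"
  by (induction n) auto

lemma sigma_funpow_inv: "(inv \<sigma> ^^ n) ((\<sigma> ^^ n) d) = d"
proof (induction n arbitrary: d)
  case (Suc n)
  then show ?case by (simp add: funpow_swap1)
qed simp

lemma phi_funpow: "d \<in> D \<Longrightarrow> \<phi> ((\<sigma> ^^ n) d) = (inv \<sigma> ^^ n) (\<phi> d)"
  by (induction n) (auto simp: phi_sigma sigma_funpow_in)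

lemma phi_vx: "d \<in> D \<Longrightarrow> x \<in> vx d \<Longrightarrow> vx (\<phi> x) = vx (\<phi> d)"
proof -
  assume d: "d \<in> D" "x \<in> vx d"
  have "x \<in> {x \<in> D. vx (\<phi> x) = vx (\<phi> d)}"
    by (rule vx_closed[OF _ d(2)]) (use d(1) in \<open>auto simp: phi_sigma\<close>)
  then show ?thesis by simp
qed

text \<open>If \<open>\<phi>\<close> moves \<open>d\<close> forward by \<open>n\<close> rotation
  steps, it moves the dart reached there backward by \<open>n\<close> steps.\<close>

lemma phi_phi_fixed_vertex:
  assumes "d \<in> D" "\<phi> d \<in> vx d"
  shows "\<phi> (\<phi> d) = d"
proof -
  obtain n where "\<phi> d = (\<sigma> ^^ n) d" using assms(2) in_vx_iff by blast
  then show ?thesis using phi_funpow[OF assms(1), of n] by (simp add: sigma_funpow_inv)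
qed

lemma marked_dart:
  assumes "v \<in> {v0 Op, v1 Op, v2 Op}"
  obtains d where "d \<in> D" "v = vx d" "\<phi> d \<in> vx d"
proof -
  have v: "v \<in> vertices Op" "fixes_vertex \<phi> v" using assms marked_in fixes_marked by auto
  then obtain d where "d \<in> D" "v = vx d" by (auto simp: vertices_def)
  moreover from this have "\<phi> d \<in> vx d" using v(2) self_in_vx[of d] unfolding fixes_vertex_def by blast
  ultimately show ?thesis by (rule that)
qed

text \<open>The square of \<open>\<phi>\<close> commutes with \<open>\<theta>\<close> and
  \<open>\<sigma>\<close>, and it fixes a dart at a marked vertex; by connectedness it is the
  identity on all darts.\<close>

lemma phi_phi: "d \<in> D \<Longrightarrow> \<phi> (\<phi> d) = d"
proof -
  assume "d \<in> D"
  have "{d \<in> D. \<phi> (\<phi> d) = d} = D"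
  proof (rule darts_connected)
    obtain d0 where "d0 \<in> D" "\<phi> d0 \<in> vx d0" using marked_dart by blast
    then show "{d \<in> D. \<phi> (\<phi> d) = d} \<noteq> {}" using phi_phi_fixed_vertex by blast
  qed (auto simp: phi_theta phi_sigma phi_sigma_inv phi_in)
  then show ?thesis using \<open>d \<in> D\<close> by blast
qed

section \<open>Colours in a triangulation\<close>

lemma col_range: "d \<in> D \<Longrightarrow> col d = 0 \<or> col d = 1 \<or> col d = 2"
  and col_theta: "d \<in> D \<Longrightarrow> col (\<theta> d) \<noteq> col d"
  using lopsp by (auto simp: lopsp_operation_def coloured_and_marked_def dest: not_sym)

lemma card_orbit_fn: "d \<in> D \<Longrightarrow> card (orbit fn d) = 3"
  using lopsp by (auto simp: lopsp_operation_def faces_def)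

lemma fn_fn_fn: "d \<in> D \<Longrightarrow> fn (fn (fn d)) = d"
  using orbit_3_cycle(1)[OF fin face_next_perm] card_orbit_fn by blast

lemma fn_fn: "d \<in> D \<Longrightarrow> fn (fn d) = \<theta> (\<sigma> d)"
  using fn_fn_fn[of "\<theta> (\<sigma> d)"] by simp

text \<open>The darts \<open>d\<close>, \<open>fn d\<close> and \<open>\<theta> (\<sigma> d)\<close>
  are the sides of the triangle to the left of \<open>d\<close> and start at its three
  corners.\<close>

lemma third_colour:
  assumes "d \<in> D"
  shows "col (\<theta> (\<sigma> d)) \<noteq> col d" "col (\<theta> (\<sigma> d)) \<noteq> col (\<theta> d)"
proof -
  show "col (\<theta> (\<sigma> d)) \<noteq> col d" using col_theta[of "\<sigma> d"] assms by simp
  have "col (\<theta> (\<sigma> d)) = col (\<theta> (fn d))" using fn_fn[OF assms] vx_face_next[of "fn d"] by simp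
  then show "col (\<theta> (\<sigma> d)) \<noteq> col (\<theta> d)" using col_theta[of "fn d"] assms by simp
qed

text \<open>The three colours at a triangle add up to 0 + 1 + 2 = 3. Two different colours never add
  up to more than 3, so the subtraction of naturals is harmless.\<close>

lemma col_theta_sigma:
  assumes "d \<in> D"
  shows "col (\<theta> (\<sigma> d)) = 3 - col d - col (\<theta> d)"
  using third_colour[OF assms] col_theta[OF assms] col_range[of "\<theta> (\<sigma> d)"] col_range[of d]
    col_range[of "\<theta> d"] assms by auto

lemma col_theta_sigma_inv:
  assumes "d \<in> D"
  shows "col (\<theta> (inv \<sigma> d)) = 3 - col d - col (\<theta> d)"
  using col_theta_sigma[of "inv \<sigma> d"] col_theta[of "inv \<sigma> d"] third_colour[of "inv \<sigma> d"]
    col_range[of "\<theta> (inv \<sigma> d)"] col_range[of d] col_range[of "\<theta> d"] assms by auto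

lemma card_face_set: "A \<in> face_sets \<Longrightarrow> card A = 3 * card (orbit fn ` A)"
proof -
  assume A: "A \<in> face_sets"
  then have AD: "A \<subseteq> D" by (simp add: face_sets_def)
  have sub: "orbit fn d \<subseteq> A" if "d \<in> A" for d
  proof
    fix x assume "x \<in> orbit fn d"
    then show "x \<in> A" by (induction rule: orbit.induct) (use that face_set_iff[OF A] in auto)
  qed
  have "\<Union>(orbit fn ` A) = A" using sub self_in_orbit_permutes[OF fin face_next_perm] by blast
  moreover have "card (\<Union>(orbit fn ` A)) = sum card (orbit fn ` A)"
  proof (rule card_Union_disjoint)
    have "orbit fn ` A \<subseteq> orbit fn ` D" using AD by blast
    then show "pairwise disjnt (orbit fn ` A)"
      using orbits_partition(2)[OF fin face_next_perm] pairwise_subset by blast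
    show "finite X" if "X \<in> orbit fn ` A" for X
    proof -
      have "card X = 3" using that card_orbit_fn AD by blast
      then show ?thesis by (intro card_ge_0_finite) simp
    qed
  qed
  moreover have "sum card (orbit fn ` A) = sum (\<lambda>_. 3) (orbit fn ` A)"
    using card_orbit_fn AD by (intro sum.cong) auto
  ultimately show ?thesis by simp
qed

lemma card_darts_faces: "card D = 3 * card (faces Op)"
  using card_face_set[of D] by (simp add: face_sets_def faces_def image_subset_iff)

text \<open>Every triangle has exactly one corner of each colour. Thus the degrees of the vertices
  of any one colour add up to the number of faces.\<close>

lemma card_colour_darts:
  assumes "i \<in> {0, 1, 2}"
  shows "card {d \<in> D. col d = i} = card (faces Op)"
proof -
  have "bij_betw (orbit fn) {d \<in> D. col d = i} (faces Op)"
  proof (rule bij_betwI')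
    fix d e assume d: "d \<in> {d \<in> D. col d = i}" and e: "e \<in> {d \<in> D. col d = i}"
    show "orbit fn d = orbit fn e \<longleftrightarrow> d = e"
    proof
      assume "orbit fn d = orbit fn e"
      then have "e \<in> orbit fn d" using self_in_orbit_permutes[OF fin face_next_perm] by blast
      then have "e \<in> {d, fn d, fn (fn d)}" using orbit_subset_3[of fn d] fn_fn_fn d by blast
      moreover have "col (fn d) \<noteq> col d" "col (fn (fn d)) \<noteq> col d"
        using d third_colour[of d] col_theta[of d] by (auto simp: fn_fn)
      ultimately show "d = e" using d e by auto
    qed simp
  next
    fix d assume "d \<in> {d \<in> D. col d = i}"
    then show "orbit fn d \<in> faces Op" by (auto simp: faces_def)
  next
    fix f assume "f \<in> faces Op"
    then obtain d where d: "d \<in> D" "f = orbit fn d" by (auto simp: faces_def)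
    have "i = col d \<or> i = col (fn d) \<or> i = col (fn (fn d))"
      using assms third_colour[OF d(1)] col_theta[OF d(1)] col_range[of d] col_range[of "\<theta> d"]
        col_range[of "\<theta> (\<sigma> d)"] d(1) by (auto simp: fn_fn)
    moreover have "orbit fn (fn d) = f" "orbit fn (fn (fn d)) = f"
      unfolding d(2) by (intro orbit_eq_permutes[OF fin face_next_perm] orbit.intros)+
    moreover have "fn d \<in> D" "fn (fn d) \<in> D" using d(1) by simp_all
    ultimately show "\<exists>x\<in>{d \<in> D. col d = i}. f = orbit fn x" using d by blast
  qed
  then show ?thesis by (rule bij_betw_same_card)
qed

lemma card_colour_vertices:
  assumes "i \<in> {0, 1, 2}" "\<And>v. v \<in> vertices Op \<Longrightarrow> colour Op v = i \<Longrightarrow> card v = 4"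
  shows "4 * card {v \<in> vertices Op. colour Op v = i} = card (faces Op)"
proof -
  let ?V = "{v \<in> vertices Op. colour Op v = i}"
  have "\<Union>?V = {d \<in> D. col d = i}"
  proof (intro set_eqI iffI)
    fix d assume "d \<in> \<Union>?V"
    then obtain v where v: "v \<in> vertices Op" "colour Op v = i" "d \<in> v" by blast
    then show "d \<in> {d \<in> D. col d = i}"
      using in_vertex_eq[OF v(1,3)] vertex_subset[OF v(1)] by auto
  next
    fix d assume "d \<in> {d \<in> D. col d = i}"
    then show "d \<in> \<Union>?V" by (auto intro!: exI[of _ "vx d"])
  qed
  moreover have "card (\<Union>?V) = sum card ?V"
    using vertices_partition(2) vertex_finite
    by (intro card_Union_disjoint) (auto simp: pairwise_def)
  moreover have "sum card ?V = 4 * card ?V" using assms(2) by simp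
  ultimately show ?thesis using card_colour_darts[OF assms(1)] by simp
qed

text \<open>
  If the reflection swapped two colours, then one of them would be 1 and the common colour of
  the marked vertices the third one. All vertices of the two swapped colours would have degree 4,
  and by Euler's formula only two vertices would be left for the third colour.
\<close>

lemma not_swapping:
  assumes "c = 0 \<or> c = 2"
    and "\<And>v. v \<in> vertices Op \<Longrightarrow> colour Op v \<noteq> c \<Longrightarrow> card v = 4"
    and "colour Op (v0 Op) = c" "colour Op (v1 Op) = c" "colour Op (v2 Op) = c"
  shows False
proof -
  let ?V = "\<lambda>i. {v \<in> vertices Op. colour Op v = i}"
  have col_v: "colour Op v \<in> {0, 1, 2}" if "v \<in> vertices Op" for v
    using that lopsp by (auto simp: lopsp_operation_def coloured_and_marked_def)
  have "v \<in> ?V c \<union> (?V 1 \<union> ?V (2 - c))" if "v \<in> vertices Op" for v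
    using assms(1) col_v[OF that] that by auto
  then have "vertices Op = ?V c \<union> (?V 1 \<union> ?V (2 - c))" by blast
  then have "card (vertices Op) = card (?V c \<union> (?V 1 \<union> ?V (2 - c)))" by simp
  also have "\<dots> = card (?V c) + (card (?V 1) + card (?V (2 - c)))"
  proof -
    have "card (?V 1 \<union> ?V (2 - c)) = card (?V 1) + card (?V (2 - c))"
      using finite_vertices assms(1) by (intro card_Un_disjoint) auto
    moreover have "card (?V c \<union> (?V 1 \<union> ?V (2 - c))) = card (?V c) + card (?V 1 \<union> ?V (2 - c))"
      using finite_vertices assms(1) by (intro card_Un_disjoint) auto
    ultimately show ?thesis by simp
  qed
  finally have V: "card (vertices Op) = card (?V c) + (card (?V 1) + card (?V (2 - c)))" .
  have 4: "4 * card (?V 1) = card (faces Op)" "4 * card (?V (2 - c)) = card (faces Op)"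
    using assms(1,2) by (auto intro!: card_colour_vertices)
  have "{v0 Op, v1 Op, v2 Op} \<subseteq> ?V c" using marked_in assms(3-5) by auto
  then have "card {v0 Op, v1 Op, v2 Op} \<le> card (?V c)" using finite_vertices by (intro card_mono) auto
  then have "3 \<le> card (?V c)" using marked_distinct by auto
  moreover have "int (card (vertices Op)) - int (card (edges Op)) + int (card (faces Op)) = 2"
    using lopsp by (simp add: lopsp_operation_def plane_map_def)
  \<comment> \<open>With F faces there are 3F/2 edges and F/4 vertices of each of the two colours
    other than \<open>c\<close>. Euler's formula then gives exactly 2 vertices of colour
    \<open>c\<close>, fewer than the three marked ones.\<close>
  ultimately show False using V 4 card_darts_edges card_darts_faces by linarith
qed

text \<open>\<open>t\<close> stands for an action of \<open>\<phi>\<close> on the colours; the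
  hypothesis on it says that it commutes with taking the third colour of a triangle. As the colours
  at an edge determine those of the adjacent triangles, agreement at one edge spreads over the
  map.\<close>

lemma col_phi_all:
  assumes t: "\<And>a b. a \<noteq> b \<Longrightarrow> a \<le> 2 \<Longrightarrow> b \<le> 2 \<Longrightarrow> t (3 - a - b) = 3 - t a - (t b :: nat)"
    and d0: "d0 \<in> D" "col (\<phi> d0) = t (col d0)" "col (\<phi> (\<theta> d0)) = t (col (\<theta> d0))"
    and "d \<in> D"
  shows "col (\<phi> d) = t (col d)"
proof -
  let ?S = "{d \<in> D. col (\<phi> d) = t (col d) \<and> col (\<phi> (\<theta> d)) = t (col (\<theta> d))}"
  have "?S = D"
  proof (rule darts_connected)
    show "?S \<noteq> {}" using d0 by blast
    fix d assume d: "d \<in> ?S"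
    then show "\<theta> d \<in> ?S" by simp
    have dD: "d \<in> D" using d by simp
    have "col (\<phi> (\<theta> (\<sigma> d))) = 3 - col (\<phi> d) - col (\<theta> (\<phi> d))"
      using dD by (simp add: phi_theta phi_sigma phi_in col_theta_sigma_inv)
    also have "\<dots> = 3 - t (col d) - t (col (\<theta> d))" using d dD by (simp add: phi_theta)
    also have "\<dots> = t (3 - col d - col (\<theta> d))"
    proof (rule t[symmetric])
      show "col d \<noteq> col (\<theta> d)" using col_theta[OF dD] by simp
      show "col d \<le> 2" "col (\<theta> d) \<le> 2" using col_range[of d] col_range[of "\<theta> d"] dD by auto
    qed
    also have "\<dots> = t (col (\<theta> (\<sigma> d)))" using col_theta_sigma[OF dD] by simp
    finally show "\<sigma> d \<in> ?S" using d by (simp add: phi_sigma)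
  qed auto
  then show ?thesis using \<open>d \<in> D\<close> by blast
qed

lemma card_phi_vertex:
  assumes "d \<in> D"
  shows "card (vx (\<phi> d)) = card (vx d)"
proof -
  have le: "card (vx d) \<le> card (vx (\<phi> d))" if d: "d \<in> D" for d
  proof (rule card_inj_on_le)
    show "inj_on \<phi> (vx d)" using vx_subset[OF d] phi_inj by (auto simp: inj_on_def subset_iff)
    show "\<phi> ` vx d \<subseteq> vx (\<phi> d)" using phi_vx[OF d] vx_eq_iff by auto
    show "finite (vx (\<phi> d))" using vx_subset[OF phi_in[OF d]] fin finite_subset by blast
  qed
  show ?thesis using le[OF assms] le[OF phi_in[OF assms]] phi_phi[OF assms] by simp
qed

lemma col_phi:
  assumes "d \<in> D"
  shows "col (\<phi> d) = col d"
proof -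
  obtain d0 where d0: "d0 \<in> D" "v0 Op = vx d0" "\<phi> d0 \<in> vx d0" using marked_dart by blast
  obtain d1 where d1: "d1 \<in> D" "v1 Op = vx d1" "\<phi> d1 \<in> vx d1" using marked_dart by blast
  obtain d2 where d2: "d2 \<in> D" "v2 Op = vx d2" "\<phi> d2 \<in> vx d2" using marked_dart by blast
  have col_eq: "col (\<phi> d0) = col d0" "col (\<phi> d1) = col d1" "col (\<phi> d2) = col d2"
    using vx_eq[OF d0(3)] vx_eq[OF d1(3)] vx_eq[OF d2(3)] by simp_all
  show ?thesis
  proof (cases "col (\<phi> (\<theta> d0)) = col (\<theta> d0)")
    case True
    then show ?thesis using col_phi_all[of "\<lambda>x. x" d0 d] col_eq d0(1) assms by simp
  next
    case False
    define c where "c = col d0"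
    \<comment> \<open>The transposition of the two colours other than \<open>c\<close>. Since the
      colour \<open>c\<close> of \<open>v0 Op\<close> is kept, it is the only alternative to the
      identity.\<close>
    define t where "t x = (if x = c then c else 3 - c - x)" for x
    have c_range: "c = 0 \<or> c = 2"
      using lopsp col_range[OF d0(1)] d0(2) by (auto simp: c_def lopsp_operation_def coloured_and_marked_def)
    have t_eq: "t (3 - a - b) = 3 - t a - t b" if "a \<noteq> b" "a \<le> 2" "b \<le> 2" for a b
    proof -
      have "a = 0 \<or> a = 1 \<or> a = 2" "b = 0 \<or> b = 1 \<or> b = 2" using that by auto
      then show ?thesis using c_range that(1) by (elim disjE) (simp_all add: t_def)
    qed
    have "col (\<phi> (\<theta> d0)) \<noteq> c" "col (\<theta> d0) \<noteq> c"
      using col_theta[OF phi_in[OF d0(1)]] col_theta[OF d0(1)] col_eq(1) d0(1) by (auto simp: c_def phi_theta)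
    then have "col (\<phi> (\<theta> d0)) = t (col (\<theta> d0))"
      using False col_range[of "\<phi> (\<theta> d0)"] col_range[of "\<theta> d0"] d0(1) phi_in[of "\<theta> d0"] c_range
      by (auto simp: t_def)
    moreover have "col (\<phi> d0) = t (col d0)" using col_eq(1) by (simp add: t_def c_def)
    ultimately have swap: "col (\<phi> d) = t (col d)" if "d \<in> D" for d
      using col_phi_all[of t d0 d] t_eq d0(1) that by blast
    have t_fixed: "x = c" if "t x = x" "x = 0 \<or> x = 1 \<or> x = 2" for x
    proof (rule ccontr)
      assume "x \<noteq> c"
      then have "3 - c - x = x" using that(1) by (simp add: t_def)
      then show False using that(2) c_range \<open>x \<noteq> c\<close> by (elim disjE) simp_all
    qed
    \<comment> \<open>The other marked vertices are fixed too, so their colours are fixed by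
      \<open>t\<close>.\<close>
    have "col d1 = c"
      by (rule t_fixed) (use swap[OF d1(1)] col_eq(2) col_range[OF d1(1)] in simp_all)
    moreover have "col d2 = c"
      by (rule t_fixed) (use swap[OF d2(1)] col_eq(3) col_range[OF d2(1)] in simp_all)
    ultimately have marked_c: "colour Op (v0 Op) = c" "colour Op (v1 Op) = c" "colour Op (v2 Op) = c"
      using d0(2) d1(2) d2(2) by (simp_all add: c_def)
    have four: "card v = 4" if "v \<in> vertices Op" "colour Op v = 1" for v
    proof -
      have "v \<notin> {v0 Op, v1 Op, v2 Op}" using that(2) marked_c c_range by auto
      then show ?thesis using that lopsp by (simp add: lopsp_operation_def)
    qed
    have "card v = 4" if v: "v \<in> vertices Op" "colour Op v \<noteq> c" for v
    proof (cases "colour Op v = 1")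
      case False
      obtain d where d: "d \<in> D" "v = vx d" using v(1) by (auto simp: vertices_def)
      \<comment> \<open>The remaining colour is exchanged with 1, and \<open>\<phi>\<close>
        preserves degrees, so these vertices inherit degree 4.\<close>
      have "col (\<phi> d) = 1" using swap[OF d(1)] v(2) d False col_range[OF d(1)] c_range by (auto simp: t_def)
      then have "card (vx (\<phi> d)) = 4" using four phi_in[OF d(1)] by simp
      then show ?thesis using card_phi_vertex[OF d(1)] d(2) by simp
    qed (use four v in blast)
    then show ?thesis using not_swapping[OF c_range _ marked_c] by blast
  qed
qed

section \<open>Fixed darts\<close>

definition fixed :: "'a set" where
  "fixed = {d \<in> D. \<phi> d = d}"

lemma theta_fixed [simp]: "\<theta> d \<in> fixed \<longleftrightarrow> d \<in> fixed"
  using phi_theta by (auto simp: fixed_def)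

text \<open>Consecutive neighbours lie on a common triangle, so around a vertex they alternate
  between the two colours other than its own. A rotation that respects the colour of a neighbour
  therefore has an even number of steps.\<close>

lemma col_theta_funpow:
  assumes "d \<in> D"
  shows "col (\<theta> ((\<sigma> ^^ n) d)) = (if even n then col (\<theta> d) else 3 - col d - col (\<theta> d))"
proof (induction n)
  case (Suc n)
  have "(\<sigma> ^^ n) d \<in> D" using assms by (rule sigma_funpow_in)
  moreover have "col ((\<sigma> ^^ n) d) = col d" by (induction n) auto
  moreover have "3 - col d - (3 - col d - col (\<theta> d)) = col (\<theta> d)"
    using col_range[of d] col_range[of "\<theta> d"] col_theta[of d] assms by auto
  ultimately show ?case using Suc col_theta_sigma[of "(\<sigma> ^^ n) d"] by auto
qed simp

lemma col_theta_funpow_even: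
  assumes "d \<in> D" "col (\<theta> ((\<sigma> ^^ n) d)) = col (\<theta> d)"
  shows "even n"
  using col_theta_funpow[OF assms(1), of n] assms(2) third_colour[OF assms(1)] col_theta_sigma[OF assms(1)]
  by (auto split: if_splits)

text \<open>On the darts of the vertex \<open>\<phi>\<close> reflects a cyclic order. If it moves
  \<open>d\<close> by \<open>k\<close> steps, then \<open>k\<close> is even because colours are
  preserved, and the dart \<open>x\<close> halfway is fixed. The degree \<open>n = 2 * m\<close> is
  even for the same reason. The dart \<open>i\<close> steps after \<open>x\<close> is fixed iff
  \<open>n\<close> divides \<open>2 * i\<close>, which leaves \<open>x\<close> and the opposite
  dart.\<close>

lemma fixed_darts_of_vertex:
  assumes "d \<in> D" "\<phi> d \<in> vx d"
  shows "card (vx d \<inter> fixed) = 2"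
proof -
  have eq: "(inv \<sigma> ^^ n) y = z \<longleftrightarrow> y = (\<sigma> ^^ n) z" for n y z
  proof
    have "(\<sigma> ^^ n) ((inv \<sigma> ^^ n) y) = y"
      by (induction n arbitrary: y) (simp_all add: funpow_swap1)
    then show "(inv \<sigma> ^^ n) y = z \<Longrightarrow> y = (\<sigma> ^^ n) z" by auto
  qed (simp add: sigma_funpow_inv)
  obtain k where k: "\<phi> d = (\<sigma> ^^ k) d" using assms(2) in_vx_iff by blast
  have "col (\<theta> (\<phi> d)) = col (\<theta> d)" using col_phi[of "\<theta> d"] assms(1) by (simp add: phi_theta)
  then have "even k" using col_theta_funpow_even[OF assms(1)] k by simp
  then obtain j where j: "k = j + j" by (metis evenE mult_2)
  define x where "x = (\<sigma> ^^ j) d"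
  have xD: "x \<in> D" using assms(1) sigma_funpow_in by (simp add: x_def)
  have "\<phi> x = (inv \<sigma> ^^ j) ((\<sigma> ^^ k) d)" using phi_funpow[OF assms(1), of j] k by (simp add: x_def)
  also have "\<dots> = x" unfolding eq x_def j by (simp add: funpow_add)
  finally have \<phi>x: "\<phi> x = x" .
  have vx: "vx d = vx x" using in_vx_iff vx_eq x_def by blast
  have perm: "permutation \<sigma>" using fin sigma_perm permutation_permutes by blast
  define n where "n = least_power \<sigma> x"
  have n: "(\<sigma> ^^ i) x = x \<longleftrightarrow> n dvd i" for i
    unfolding n_def using least_power_dvd[OF perm] by blast
  have n0: "n > 0" unfolding n_def using least_power_of_permutation(2)[OF perm] .
  have "even n" using col_theta_funpow_even[OF xD, of n] n[of n] by simp
  then obtain m where m: "n = 2 * m" by blast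
  have fixed_iff: "(\<sigma> ^^ i) x \<in> fixed \<longleftrightarrow> m dvd i" for i
  proof -
    have "(\<sigma> ^^ i) x \<in> fixed \<longleftrightarrow> (\<sigma> ^^ (i + i)) x = x"
      using sigma_funpow_in[OF xD] phi_funpow[OF xD, of i] \<phi>x eq[of i x "(\<sigma> ^^ i) x"]
      by (auto simp: fixed_def funpow_add)
    also have "\<dots> \<longleftrightarrow> 2 * m dvd 2 * i" using n m by (simp add: mult_2)
    finally show ?thesis by simp
  qed
  have "vx d \<inter> fixed = {x, (\<sigma> ^^ m) x}"
  proof (intro subset_antisym subsetI)
    fix y assume y: "y \<in> vx d \<inter> fixed"
    then obtain i where i: "y = (\<sigma> ^^ i) x" using vx in_vx_iff by auto
    then have "m dvd i" using y fixed_iff by auto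
    then obtain q where q: "i = m * q" by (rule dvdE)
    have mod: "(\<sigma> ^^ (n * r)) x = x" for r using n by simp
    show "y \<in> {x, (\<sigma> ^^ m) x}"
    proof (cases "even q")
      case True
      then obtain r where "q = 2 * r" by blast
      then have "i = n * r" using q m by simp
      then show ?thesis using mod i by simp
    next
      case False
      then obtain r where "q = 2 * r + 1" by (rule oddE)
      then have "i = m + n * r" using q m by (simp add: algebra_simps)
      then show ?thesis using mod i by (simp add: funpow_add)
    qed
  next
    fix y assume "y \<in> {x, (\<sigma> ^^ m) x}"
    moreover have "x \<in> fixed" using fixed_iff[of 0] by simp
    moreover have "(\<sigma> ^^ m) x \<in> fixed" using fixed_iff[of m] by simp
    moreover have "x \<in> vx d" "(\<sigma> ^^ m) x \<in> vx d" unfolding vx using in_vx_iff self_in_vx by blast+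
    ultimately show "y \<in> vx d \<inter> fixed" by auto
  qed
  moreover have "(\<sigma> ^^ m) x \<noteq> x"
  proof
    assume "(\<sigma> ^^ m) x = x"
    then have "2 * m dvd m" using n m by simp
    then have "2 * m \<le> m" using n0 m by (intro dvd_imp_le) auto
    then show False using n0 m by simp
  qed
  ultimately show ?thesis by simp
qed

end

section \<open>Cutting along the fixed edges\<close>

lemma orbit_cong_closed:
  assumes "d \<in> A" "\<And>x. x \<in> A \<Longrightarrow> f x \<in> A" "\<And>x. x \<in> A \<Longrightarrow> g x = f x"
  shows "orbit g d = orbit f d"
proof (intro subset_antisym subsetI)
  fix x assume "x \<in> orbit f d"
  then have "x \<in> A \<and> x \<in> orbit g d"
  proof (induction rule: orbit.induct)
    case base
    then show ?case using assms orbit.base[of g d] by simp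
  next
    case (step y)
    then show ?case using assms orbit.step[of y g d] by simp
  qed
  then show "x \<in> orbit g d" by simp
next
  fix x assume "x \<in> orbit g d"
  then have "x \<in> A \<and> x \<in> orbit f d"
  proof (induction rule: orbit.induct)
    case base
    then show ?case using assms orbit.base[of f d] by simp
  next
    case (step y)
    then show ?case using assms orbit.step[of y f d] by simp
  qed
  then show "x \<in> orbit f d" by simp
qed

context lopsp_reflection
begin

lemma plane: "plane_map Op"
  using lopsp by (simp add: lopsp_operation_def)

lemma phi_fixed_iff: "d \<in> D \<Longrightarrow> \<phi> d \<in> fixed \<longleftrightarrow> d \<in> fixed"
  using phi_in phi_phi phi_inj by (auto simp: fixed_def)

lemma fixed_vertex_card: "x \<in> fixed \<Longrightarrow> card (vx x \<inter> fixed) = 2"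
  using fixed_darts_of_vertex[of x] by (simp add: fixed_def)

lemma fixed_even: "fixed \<in> even_sets"
proof -
  have "even (card (v \<inter> fixed))" if v: "v \<in> vertices Op" for v
  proof (cases "v \<inter> fixed = {}")
    case False
    then obtain x where x: "x \<in> v" "x \<in> fixed" by blast
    then show ?thesis using fixed_vertex_card[OF x(2)] in_vertex_eq[OF v x(1)] by simp
  qed simp
  moreover have "\<theta> ` fixed \<subseteq> fixed" by auto
  moreover have "fixed \<subseteq> D" by (auto simp: fixed_def)
  ultimately show ?thesis by (simp add: even_sets_def)
qed

lemma marked_meets_fixed:
  assumes "v \<in> {v0 Op, v1 Op, v2 Op}"
  obtains x where "x \<in> fixed" "v = vx x"
proof -
  obtain d where d: "d \<in> D" "v = vx d" "\<phi> d \<in> vx d" using marked_dart[OF assms] .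
  then have "vx d \<inter> fixed \<noteq> {}" using fixed_darts_of_vertex[OF d(1,3)] by auto
  then obtain x where "x \<in> fixed" "x \<in> vx d" by blast
  then show ?thesis using that vx_eq d(2) by blast
qed

text \<open>
  The map \<open>\<phi> \<circ> \<theta>\<close> acts on faces. It preserves the boundary of \<open>B\<close>, so it maps \<open>B\<close> to itself or to
  its complement, and the former is impossible at a fixed edge.
\<close>

lemma opposite_side:
  assumes B: "B \<in> face_sets" "bd B \<subseteq> fixed" "bd B \<noteq> {}" and d: "d \<in> D"
  shows "d \<in> B \<longleftrightarrow> \<phi> (\<theta> d) \<notin> B"
proof -
  define B' where "B' = {d \<in> D. \<phi> (\<theta> d) \<in> B}"
  have "fn d \<in> B'" if "d \<in> B'" for d
  proof -
    have d: "d \<in> D" "\<phi> (\<theta> d) \<in> B" using that by (auto simp: B'_def)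
    have "\<phi> (\<theta> (fn d)) = \<theta> (\<sigma> (\<phi> (\<theta> d)))"
      using d(1) by (simp add: face_next_def phi_theta phi_sigma_inv)
    moreover have "\<theta> (\<sigma> (\<phi> (\<theta> d))) \<in> B"
      using face_set_iff[OF B(1), of "\<theta> (\<sigma> (\<phi> (\<theta> d)))"] d(2) by simp
    ultimately show ?thesis using d(1) by (simp add: B'_def)
  qed
  then have "B' \<in> face_sets" by (auto simp: face_sets_def B'_def)
  moreover have "bd B' = bd B"
  proof -
    have "d \<in> bd B' \<longleftrightarrow> d \<in> bd B" if d: "d \<in> D" for d
    proof -
      have "d \<in> bd B' \<longleftrightarrow> \<phi> d \<in> bd B"
        using d phi_in[OF d] by (auto simp: bd_def B'_def phi_theta)
      \<comment> \<open>\<open>\<phi>\<close> is the identity on \<open>bd B\<close>, which consists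
        of fixed darts, and it maps darts that are not fixed to darts that are not fixed.\<close>
      also have "\<dots> \<longleftrightarrow> d \<in> bd B"
      proof (cases "d \<in> fixed")
        case True
        then show ?thesis by (simp add: fixed_def)
      next
        case False
        then show ?thesis using B(2) phi_fixed_iff[OF d] by blast
      qed
      finally show ?thesis .
    qed
    then show ?thesis using bd_subset by blast
  qed
  ultimately have cases: "B' = B \<or> B' = D - B" using bd_eq_cases[OF B(1)] by metis
  obtain e where e: "e \<in> bd B" using B(3) by blast
  then have "e \<in> D" "\<phi> e = e" "(e \<in> B) \<noteq> (\<theta> e \<in> B)" using B(2) by (auto simp: fixed_def bd_def)
  then have "e \<in> B' \<longleftrightarrow> e \<notin> B" by (auto simp: B'_def phi_theta)
  then have "B' = D - B" using cases by blast
  then show ?thesis using d by (auto simp: B'_def)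
qed

text \<open>For a fixed dart, \<open>\<phi> \<circ> \<theta>\<close> just exchanges the two sides of
  its edge, so exactly one side is in \<open>B\<close>. Consequently no proper nonempty subset of
  the fixed edges is a boundary, which makes the fixed edges a single cycle.\<close>

lemma fixed_subset_bd:
  assumes "B \<in> face_sets" "bd B \<subseteq> fixed" "bd B \<noteq> {}"
  shows "fixed \<subseteq> bd B"
proof
  fix x assume x: "x \<in> fixed"
  then have "x \<in> D" "\<phi> x = x" by (auto simp: fixed_def)
  then show "x \<in> bd B" using opposite_side[OF assms, of x] by (auto simp: bd_def phi_theta)
qed

end

locale lopsp_cut = lopsp_reflection Op \<phi> for Op :: "'a marked_map" and \<phi> +
  fixes A :: "'a set"
  assumes A: "A \<in> face_sets" and bd_A: "bd A = fixed"
begin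

text \<open>The darts of all edges with a face of \<open>A\<close> on at least one side.
  \<open>A\<close> contains only one dart of each fixed edge; adding the other one gives closure
  under \<open>\<theta>\<close>.\<close>

definition C where "C = A \<union> fixed"

section \<open>The two sides of the fixed cycle\<close>

lemma A_subset: "A \<subseteq> D" and fixed_subset: "fixed \<subseteq> D" and C_subset: "C \<subseteq> D"
  using A by (auto simp: face_sets_def fixed_def C_def)

lemma fixed_nonempty: "fixed \<noteq> {}"
  using marked_meets_fixed by blast

lemma opposite: "d \<in> D \<Longrightarrow> d \<in> A \<longleftrightarrow> \<phi> (\<theta> d) \<notin> A"
  using opposite_side[OF A] bd_A fixed_nonempty by auto

lemma theta_A: "d \<in> D \<Longrightarrow> \<theta> d \<in> A \<longleftrightarrow> (d \<in> A) \<noteq> (d \<in> fixed)"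
  using bd_A by (auto simp: bd_def)

lemma sigma_A: "d \<in> D \<Longrightarrow> \<sigma> d \<in> A \<longleftrightarrow> (d \<in> A) \<noteq> (\<sigma> d \<in> fixed)"
proof -
  assume "d \<in> D"
  then have "\<sigma> d \<in> fixed \<longleftrightarrow> (\<sigma> d \<in> A) \<noteq> (d \<in> A)"
    unfolding bd_A[symmetric] bd_eq_sigma[OF A] by simp
  then show ?thesis by blast
qed

lemma sigma_inv_A: "d \<in> D \<Longrightarrow> inv \<sigma> d \<in> A \<longleftrightarrow> (d \<in> A) \<noteq> (d \<in> fixed)"
  using sigma_A[of "inv \<sigma> d"] by auto

lemma theta_C [simp]: "\<theta> d \<in> C \<longleftrightarrow> d \<in> C"
proof (cases "d \<in> D")
  case True
  then show ?thesis using theta_A by (auto simp: C_def)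
next
  case False
  then show ?thesis using C_subset theta_in by blast
qed

lemma phi_A: "d \<in> D \<Longrightarrow> d \<notin> fixed \<Longrightarrow> \<phi> d \<in> A \<longleftrightarrow> d \<notin> A"
  using opposite[of "\<theta> d"] theta_A[of d] by simp

lemma phi_C: "d \<in> D \<Longrightarrow> \<phi> d \<in> C \<longleftrightarrow> d \<in> fixed \<or> d \<notin> C"
  using phi_A[of d] phi_fixed_iff[of d] by (auto simp: C_def)

text \<open>Along the rotation, membership in \<open>A\<close> changes exactly on arrival at a fixed
  dart. Hence one fixed dart opens the sector of \<open>A\<close> at the vertex and is in
  \<open>A\<close>, and the other closes it and is not. If they agreed, membership would be constant
  around the vertex, although it differs between \<open>a\<close> and its predecessor.\<close>

lemma fixed_pair:
  assumes "x \<in> fixed"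
  obtains p q where "vx x \<inter> fixed = {p, q}" "p \<in> A" "q \<notin> A"
proof -
  obtain a b where ab: "vx x \<inter> fixed = {a, b}" using fixed_vertex_card[OF assms] by (metis card_2_iff)
  have a: "a \<in> vx x" "a \<in> fixed" "a \<in> D" using ab fixed_subset by auto
  have inv_a: "inv \<sigma> a \<in> A \<longleftrightarrow> a \<notin> A" using sigma_inv_A[OF a(3)] a(2) by simp
  have "inv \<sigma> a \<in> vx a" by simp
  have const: "y \<in> A \<longleftrightarrow> a \<in> A" if y: "y \<in> vx a" and ab_A: "(a \<in> A) = (b \<in> A)" for y
  proof -
    have "y \<in> {y \<in> vx a. (y \<in> A) = (a \<in> A)}"
    proof (rule vx_closed[OF _ y])
      fix z assume z: "z \<in> {y \<in> vx a. (y \<in> A) = (a \<in> A)}"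
      then have zD: "z \<in> D" using vx_subset[OF a(3)] by auto
      have "\<sigma> z \<in> vx a" using z by simp
      moreover have "\<sigma> z \<in> A \<longleftrightarrow> a \<in> A"
      proof (cases "\<sigma> z \<in> fixed")
        case True
        then have "\<sigma> z \<in> {a, b}" using ab \<open>\<sigma> z \<in> vx a\<close> vx_eq[OF a(1)] by blast
        then show ?thesis using ab_A by blast
      next
        case False
        then show ?thesis using sigma_A[OF zD] z by simp
      qed
      ultimately show "\<sigma> z \<in> {y \<in> vx a. (y \<in> A) = (a \<in> A)}" by simp
    qed simp
    then show ?thesis by simp
  qed
  have "(a \<in> A) \<noteq> (b \<in> A)" using const[OF \<open>inv \<sigma> a \<in> vx a\<close>] inv_a by blast
  then show ?thesis using that[of a b] that[of b a] ab by (metis insert_commute)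
qed

section \<open>The rotation of the half\<close>

definition start where "start d = (SOME p. p \<in> vx d \<inter> fixed \<inter> A)"

lemma start:
  assumes "q \<in> fixed"
  shows "start q \<in> vx q" "start q \<in> fixed" "start q \<in> A"
    and "p \<in> vx q \<Longrightarrow> p \<in> fixed \<Longrightarrow> p \<in> A \<Longrightarrow> p = start q"
proof -
  obtain a b where ab: "vx q \<inter> fixed = {a, b}" "a \<in> A" "b \<notin> A" using fixed_pair[OF assms] .
  then have eq: "vx q \<inter> fixed \<inter> A = {a}" by auto
  then have "start q = a" unfolding start_def by simp
  then have "vx q \<inter> fixed \<inter> A = {start q}" using eq by simp
  then show "start q \<in> vx q" "start q \<in> fixed" "start q \<in> A"
    "p \<in> vx q \<Longrightarrow> p \<in> fixed \<Longrightarrow> p \<in> A \<Longrightarrow> p = start q" by blast+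
qed

lemma end_unique:
  assumes "p \<in> fixed" "q \<in> fixed" "p \<notin> A" "q \<notin> A" "vx p = vx q"
  shows "p = q"
proof -
  obtain a b where ab: "vx p \<inter> fixed = {a, b}" "a \<in> A" "b \<notin> A" using fixed_pair[OF assms(1)] .
  have "p \<in> vx p" "q \<in> vx p" using self_in_vx assms(5) by blast+
  then have "p \<in> vx p \<inter> fixed" "q \<in> vx p \<inter> fixed" using assms(1,2) by blast+
  then have "p \<in> {a, b}" "q \<in> {a, b}" unfolding ab(1) .
  then show ?thesis using ab(2) assms(3,4) by auto
qed

lemma end_exists:
  assumes "x \<in> fixed"
  obtains q where "q \<in> fixed" "q \<notin> A" "vx q = vx x"
proof -
  obtain a b where ab: "vx x \<inter> fixed = {a, b}" "a \<in> A" "b \<notin> A" using fixed_pair[OF assms] .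
  then have "b \<in> vx x" "b \<in> fixed" by auto
  then show ?thesis using that ab(3) vx_eq by blast
qed

text \<open>The rotation of \<open>Op\<close> with the removed sector closed up: from the fixed dart
  ending the sector of \<open>A\<close> it jumps to the one starting it, over what becomes the outer
  corner.\<close>

definition sig where
  "sig d = (if d \<in> A then \<sigma> d else if d \<in> fixed then start d else d)"

lemma sig_C: "d \<in> C \<Longrightarrow> sig d \<in> C"
  using start sigma_A[of d] A_subset by (auto simp: sig_def C_def)

lemma vx_sig: "d \<in> C \<Longrightarrow> vx (sig d) = vx d"
  using start(1) vx_eq by (auto simp: sig_def C_def)

lemma sig_perm: "sig permutes C"
proof (rule bij_imp_permutes)
  have inj: "inj_on sig C"
  proof (rule inj_onI)
    fix d e assume de: "d \<in> C" "e \<in> C" "sig d = sig e"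
    \<comment> \<open>A fixed dart whose predecessor lies in \<open>A\<close> closes a sector, so it
      cannot be the dart that opens one.\<close>
    have mixed: False if "d \<in> A" "e \<in> C" "e \<notin> A" "sig d = sig e" for d e
    proof -
      have "\<sigma> d = start e" "e \<in> fixed" using that by (auto simp: sig_def C_def)
      then have "\<sigma> d \<in> fixed" "\<sigma> d \<in> A" using start by auto
      then show False using sigma_A[of d] that(1) A_subset by auto
    qed
    show "d = e"
    proof (cases "d \<in> A")
      case True
      then have "e \<in> A" using mixed[of d e] de by blast
      then show ?thesis using True de(3) by (simp add: sig_def)
    next
      case False
      then have "e \<notin> A" using mixed[of e d] de by auto
      then have "d \<in> fixed" "e \<in> fixed" using False de by (auto simp: C_def)
      moreover have "vx d = vx e" using vx_sig de by metis
      ultimately show ?thesis using end_unique False \<open>e \<notin> A\<close> by blast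
    qed
  qed
  moreover have "sig ` C \<subseteq> C" using sig_C by blast
  moreover have "finite C" using fin C_subset finite_subset by blast
  ultimately show "bij_betw sig C C" unfolding bij_betw_def using endo_inj_surj by blast
  show "sig x = x" if "x \<notin> C" for x using that by (simp add: sig_def C_def)
qed

lemma finite_C: "finite C"
  using fin C_subset finite_subset by blast

lemma constant_off_fixed:
  assumes "d \<in> D" "vx d \<inter> fixed = {}" "x \<in> vx d"
  shows "x \<in> A \<longleftrightarrow> d \<in> A"
proof -
  have "x \<in> {x \<in> vx d. x \<in> A \<longleftrightarrow> d \<in> A}"
  proof (rule vx_closed[OF _ assms(3)])
    fix z assume z: "z \<in> {x \<in> vx d. x \<in> A \<longleftrightarrow> d \<in> A}"
    then have "z \<in> D" "\<sigma> z \<in> vx d" using vx_subset[OF assms(1)] by auto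
    moreover from this(2) have "\<sigma> z \<notin> fixed" using assms(2) by blast
    ultimately show "\<sigma> z \<in> {x \<in> vx d. x \<in> A \<longleftrightarrow> d \<in> A}" using sigma_A[of z] z by simp
  qed simp
  then show ?thesis by simp
qed

text \<open>A vertex without fixed darts lies wholly inside or wholly outside \<open>A\<close>, so
  its rotation is unchanged. At any other vertex the rotation of \<open>Op\<close> is followed from
  the closing dart \<open>q\<close>, and \<open>sig\<close> visits the darts in \<open>C\<close> in
  the same order.\<close>

lemma orbit_sig:
  assumes d: "d \<in> C"
  shows "orbit sig d = vx d \<inter> C"
proof
  show "orbit sig d \<subseteq> vx d \<inter> C"
  proof
    fix x assume "x \<in> orbit sig d"
    then have "x \<in> C \<and> vx x = vx d"
      by (induction rule: orbit.induct) (use d in \<open>auto simp: sig_C vx_sig\<close>)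
    then show "x \<in> vx d \<inter> C" using self_in_vx[of x] by simp
  qed
  show "vx d \<inter> C \<subseteq> orbit sig d"
  proof (cases "vx d \<inter> fixed = {}")
    case True
    have dD: "d \<in> D" using d C_subset by blast
    have "d \<notin> fixed" using True self_in_vx[of d] by blast
    then have "d \<in> A" using d by (simp add: C_def)
    then have "orbit sig d = orbit \<sigma> d"
    proof (intro orbit_cong_closed[of d "vx d \<inter> A"])
      fix x assume x: "x \<in> vx d \<inter> A"
      then have "\<sigma> x \<in> vx d" by simp
      then show "\<sigma> x \<in> vx d \<inter> A" using constant_off_fixed[OF dD True, of "\<sigma> x"] \<open>d \<in> A\<close> by simp
      show "sig x = \<sigma> x" using x by (simp add: sig_def)
    qed simp
    then show ?thesis by (simp add: vertex_of_def)
  next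
    case False
    then obtain x where x: "x \<in> fixed" "vx x = vx d" using vx_eq by blast
    obtain q where q: "q \<in> fixed" "q \<notin> A" "vx q = vx d" using end_exists[OF x(1)] x(2) by metis
    have qC: "q \<in> C" and qD: "q \<in> D" using q fixed_subset by (auto simp: C_def)
    \<comment> \<open>From outside \<open>A\<close> the rotation can enter \<open>C\<close> only at
      the opening dart, which is the \<open>sig\<close>-successor of \<open>q\<close>.\<close>
    have enter: "\<sigma> y \<in> orbit sig q" if y: "y \<in> vx q" "y \<notin> A" "\<sigma> y \<in> C" for y
    proof -
      have yD: "y \<in> D" using y(1) vx_subset[OF qD] by blast
      have "\<sigma> y \<in> fixed" "\<sigma> y \<in> A" using sigma_A[OF yD] y by (auto simp: C_def)
      moreover have "\<sigma> y \<in> vx q" using y(1) by simp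
      ultimately have "\<sigma> y = start q" using start(4)[OF q(1)] by blast
      then have "\<sigma> y = sig q" using q by (simp add: sig_def)
      then show ?thesis by (simp add: orbit.base)
    qed
    have in_orbit: "x \<in> C \<longrightarrow> x \<in> orbit sig q" if "x \<in> orbit \<sigma> q" for x
      using that
    proof (induction rule: orbit.induct)
      case base
      then show ?case using enter[OF self_in_vx q(2)] by simp
    next
      case (step y)
      show ?case
      proof (cases "y \<in> A")
        case True
        then have "y \<in> orbit sig q" using step.IH by (simp add: C_def)
        then have "sig y \<in> orbit sig q" by (rule orbit.step)
        moreover have "sig y = \<sigma> y" using True by (simp add: sig_def)
        ultimately show ?thesis by simp
      next
        case False
        then show ?thesis using enter[of y] step.hyps by (simp add: vertex_of_def)
      qed
    qed
    have sub: "vx d \<inter> C \<subseteq> orbit sig q"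
      using in_orbit q(3) by (auto simp: vertex_of_def)
    then have "d \<in> orbit sig q" using d by auto
    then have "orbit sig d = orbit sig q" by (rule orbit_eq_permutes[OF finite_C sig_perm])
    then show ?thesis using sub by simp
  qed
qed

text \<open>A vertex of the half is the trace on \<open>C\<close> of a single vertex of
  \<open>Op\<close>, so an arbitrary dart of it determines the colour. The darts in
  \<open>fixed - A\<close> are those that had a removed face on their left.\<close>

definition half :: "'a lsp_map" where
  "half = \<lparr> darts = C, theta = (\<lambda>d. if d \<in> C then \<theta> d else d), sigma = sig,
     colour = (\<lambda>w. col (SOME d. d \<in> w)),
     v0 = v0 Op \<inter> C, v1 = v1 Op \<inter> C, v2 = v2 Op \<inter> C, outer = fixed - A \<rparr>"

lemma half_simps [simp]:
  "darts half = C" "theta half d = (if d \<in> C then \<theta> d else d)" "sigma half = sig"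
  "colour half w = col (SOME d. d \<in> w)"
  "v0 half = v0 Op \<inter> C" "v1 half = v1 Op \<inter> C" "v2 half = v2 Op \<inter> C" "outer half = fixed - A"
  by (simp_all add: half_def)

lemma vertex_of_half: "d \<in> C \<Longrightarrow> vertex_of half d = vx d \<inter> C"
  using orbit_sig by (simp add: vertex_of_def)

lemma half_vertexE:
  assumes "w \<in> vertices half"
  obtains d where "d \<in> C" "w = vx d \<inter> C"
proof -
  obtain d where "d \<in> C" "w = vertex_of half d" using assms by (auto simp: vertices_def)
  then show ?thesis using that vertex_of_half by blast
qed

lemma vertices_half: "vertices half = (\<lambda>v. v \<inter> C) ` {v \<in> vertices Op. v \<inter> C \<noteq> {}}"
proof (intro subset_antisym subsetI)
  fix w assume "w \<in> vertices half"
  then obtain d where d: "d \<in> C" "w = vx d \<inter> C" by (rule half_vertexE)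
  then have "d \<in> D" "vx d \<inter> C \<noteq> {}" using C_subset self_in_vx[of d] by blast+
  then have "vx d \<in> {v \<in> vertices Op. v \<inter> C \<noteq> {}}" by simp
  then show "w \<in> (\<lambda>v. v \<inter> C) ` {v \<in> vertices Op. v \<inter> C \<noteq> {}}" using d(2) by blast
next
  fix w assume "w \<in> (\<lambda>v. v \<inter> C) ` {v \<in> vertices Op. v \<inter> C \<noteq> {}}"
  then obtain v d where "v \<in> vertices Op" "w = v \<inter> C" "d \<in> v" "d \<in> C" by auto
  then have "w = vertex_of half d" "d \<in> C" using in_vertex_eq vertex_of_half by auto
  then show "w \<in> vertices half" by (auto simp: vertices_def)
qed

section \<open>Connectedness of the half, by folding\<close>

definition fold where "fold d = (if d \<in> C then d else \<phi> d)"

lemma fold_C: "d \<in> D \<Longrightarrow> fold d \<in> C"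
  using phi_C by (auto simp: fold_def)

lemma fold_theta: "d \<in> D \<Longrightarrow> fold (\<theta> d) = \<theta> (fold d)"
  by (simp add: fold_def phi_theta)

text \<open>\<open>fold\<close> is the retraction of \<open>Op\<close> onto the half. A rotation
  step leaves or enters \<open>C\<close> only next to a fixed dart, where \<open>\<phi>\<close> does
  not change the vertex. With \<open>fold_theta\<close>, this carries connectedness from
  \<open>Op\<close> over to the half.\<close>

lemma vx_fold_sigma:
  assumes d: "d \<in> D"
  shows "vx (fold (\<sigma> d)) = vx (fold d)"
proof -
  consider "d \<in> C \<longleftrightarrow> \<sigma> d \<in> C" | "d \<in> C" "\<sigma> d \<notin> C" | "d \<notin> C" "\<sigma> d \<in> C" by blast
  then show ?thesis
  proof cases
    case 1
    then show ?thesis using d by (simp add: fold_def phi_sigma)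
  next
    case 2
    then have "d \<in> fixed" using sigma_A[OF d] by (auto simp: C_def)
    then show ?thesis using 2 d by (simp add: fold_def phi_sigma fixed_def)
  next
    case 3
    then have "\<sigma> d \<in> fixed" using sigma_A[OF d] by (auto simp: C_def)
    then have "inv \<sigma> (\<phi> d) = \<sigma> d" using d phi_sigma[OF d] by (simp add: fixed_def)
    then have "vx (\<phi> d) = vx d" using vx_sigma_inv[of "\<phi> d"] by simp
    then show ?thesis using 3 by (simp add: fold_def)
  qed
qed

lemma half_is_map: "is_map half"
proof -
  let ?G = "underlying_graph half"
  have "theta half permutes C"
  proof (rule bij_imp_permutes)
    show "bij_betw (theta half) C C" by (rule bij_betw_byWitness[of _ "theta half"]) auto
  qed simp
  moreover have "connected ?G"
  proof -
    have iff: "connected ?G \<longleftrightarrow> verts ?G \<noteq> {} \<and> (\<forall>S\<subseteq>verts ?G. S \<noteq> {} \<longrightarrow>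
        (\<forall>a\<in>arcs ?G. tail ?G a \<in> S \<longleftrightarrow> head ?G a \<in> S) \<longrightarrow> S = verts ?G)"
      by (rule connected_iff_no_closed_set) (auto simp: underlying_graph_def vertices_def)
    have ne: "verts ?G \<noteq> {}"
      using fixed_nonempty by (auto simp: underlying_graph_def vertices_def C_def)
    have closed: "S = vertices half" if S: "S \<subseteq> vertices half" "S \<noteq> {}"
      and closed: "\<And>a. a \<in> C \<Longrightarrow> vertex_of half a \<in> S \<longleftrightarrow> vertex_of half (\<theta> a) \<in> S" for S
    proof -
      define T where "T = {d \<in> D. vx (fold d) \<inter> C \<in> S}"
      have "T = D"
      proof (rule darts_connected)
        obtain w where "w \<in> S" using S(2) by blast
        then have "w \<in> vertices half" using S(1) by blast
        then obtain d where "d \<in> C" "vx d \<inter> C \<in> S"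
          using \<open>w \<in> S\<close> by (metis half_vertexE)
        then have "d \<in> T" using C_subset by (auto simp: T_def fold_def)
        then show "T \<noteq> {}" by blast
        fix d assume d: "d \<in> T"
        then have dD: "d \<in> D" by (simp add: T_def)
        show "\<theta> d \<in> T"
          using closed[OF fold_C[OF dD]] fold_C[OF dD] d by (simp add: T_def fold_theta vertex_of_half)
        show "\<sigma> d \<in> T" using d by (simp add: T_def vx_fold_sigma)
      qed (auto simp: T_def)
      have "w \<in> S" if w: "w \<in> vertices half" for w
      proof -
        obtain d where d: "d \<in> C" "w = vx d \<inter> C" using half_vertexE[OF w] .
        then have "d \<in> T" using C_subset \<open>T = D\<close> by auto
        then show ?thesis using d by (simp add: T_def fold_def)
      qed
      then show ?thesis using S(1) by blast
    qed
    have "S = verts ?G"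
      if S: "S \<subseteq> verts ?G" "S \<noteq> {}" "\<forall>a\<in>arcs ?G. tail ?G a \<in> S \<longleftrightarrow> head ?G a \<in> S" for S
    proof -
      have "vertex_of half a \<in> S \<longleftrightarrow> vertex_of half (\<theta> a) \<in> S" if "a \<in> C" for a
        using bspec[OF S(3), of a] that by (simp add: underlying_graph_def)
      moreover have "S \<subseteq> vertices half" using S(1) by (simp add: underlying_graph_def)
      ultimately have "S = vertices half" using S(2) by (intro closed)
      then show ?thesis by (simp add: underlying_graph_def)
    qed
    then show ?thesis unfolding iff using ne by (intro conjI allI impI)
  qed
  moreover have "theta half d \<noteq> d \<and> theta half (theta half d) = d" if "d \<in> C" for d
    using that theta_neq[OF subsetD[OF C_subset that]] by simp
  ultimately show ?thesis
    using finite_C sig_perm unfolding is_map_def half_simps(1,3) by blast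
qed

sublocale H: dart_map half
  by unfold_locales (rule half_is_map)

section \<open>The faces of the half\<close>

lemma next_half_A:
  assumes "d \<in> A"
  shows "face_next half d = fn d" "fn d \<in> A"
proof -
  show fA: "fn d \<in> A" using assms face_set_iff[OF A] by simp
  have dC: "d \<in> C" using assms by (simp add: C_def)
  have "sig (fn d) = \<theta> d" using fA by (simp add: sig_def face_next_def)
  then have "inv sig (\<theta> d) = fn d" using H.sigma_inv(2)[of "fn d"] by simp
  then show "face_next half d = fn d" using dC unfolding face_next_def by simp
qed

text \<open>The outer boundary walk reaches the vertex along the reverse of its opening dart, turns
  through the outer corner, and leaves along its closing dart.\<close>

lemma next_half_outer:
  assumes "d \<in> fixed" "d \<in> A" "q \<in> fixed" "q \<notin> A" "vx q = vx d"
  shows "face_next half (\<theta> d) = q"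
proof -
  have "sig q = d"
    using assms start(4)[OF assms(3), of d] self_in_vx[of d] by (simp add: sig_def)
  then have "inv sig d = q" using H.sigma_inv(2)[of q] by simp
  then show ?thesis using assms(1) unfolding face_next_def by (simp add: C_def)
qed

lemma theta_outer: "d \<in> fixed - A \<Longrightarrow> \<theta> d \<in> fixed \<and> \<theta> d \<in> A"
  using theta_A fixed_subset by auto

lemma outer_closed:
  assumes "q \<in> fixed - A"
  shows "face_next half q \<in> fixed - A"
proof -
  have d: "\<theta> q \<in> fixed" "\<theta> q \<in> A" using theta_outer[OF assms] by auto
  obtain r where r: "r \<in> fixed" "r \<notin> A" "vx r = vx (\<theta> q)" using end_exists[OF d(1)] .
  then show ?thesis using next_half_outer[OF d r] by simp
qed

text \<open>
  The orbit of \<open>q\<close> is a cycle of fixed edges, so it bounds a union of faces; but the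
  reflection exchanges the two sides of any such cycle, so every fixed edge lies on it.
\<close>

lemma outer_orbit:
  assumes q: "q \<in> fixed - A"
  shows "orbit (face_next half) q = fixed - A"
proof
  let ?O = "orbit (face_next half) q"
  show sub: "?O \<subseteq> fixed - A"
  proof
    fix x assume "x \<in> ?O"
    then show "x \<in> fixed - A"
      by (induction rule: orbit.induct) (use q outer_closed in blast)+
  qed
  define Z where "Z = {d. d \<in> ?O \<or> \<theta> d \<in> ?O}"
  have Z_fixed: "Z \<subseteq> fixed" using sub theta_fixed unfolding Z_def by blast
  have qO: "q \<in> ?O" by (rule self_in_orbit_permutes[OF H.fin H.face_next_perm])
  have O_iff: "face_next half x \<in> ?O \<longleftrightarrow> x \<in> ?O" for x
  proof (rule permutes_closed_iff[OF H.fin H.face_next_perm])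
    show "?O \<subseteq> H.D" using sub by (auto simp: C_def)
  qed (rule orbit.step)
  have "even (card (v \<inter> Z))" if v: "v \<in> vertices Op" for v
  proof (cases "v \<inter> fixed = {}")
    case True
    then have "v \<inter> Z = {}" using Z_fixed by blast
    then show ?thesis by simp
  next
    case False
    then obtain x where x: "x \<in> fixed" "v = vx x" using in_vertex_eq[OF v] by blast
    \<comment> \<open>The outer walk arrives along \<open>\<theta> p\<close> and continues along
      \<open>r\<close>, so \<open>Z\<close> contains both fixed darts of the vertex or
      neither.\<close>
    obtain p r where pr: "vx x \<inter> fixed = {p, r}" "p \<in> A" "r \<notin> A" using fixed_pair[OF x(1)] .
    have p: "p \<in> fixed" "p \<in> vx x" and r: "r \<in> fixed" "r \<in> vx x" using pr(1) by auto
    have "vx r = vx p" using vx_eq[OF p(2)] vx_eq[OF r(2)] by simp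
    then have "face_next half (\<theta> p) = r" using next_half_outer[OF p(1) pr(2) r(1) pr(3)] by simp
    then have "\<theta> p \<in> ?O \<longleftrightarrow> r \<in> ?O" using O_iff[of "\<theta> p"] by simp
    moreover have "p \<notin> ?O" using sub pr(2) by blast
    moreover have "\<theta> r \<notin> ?O" using sub theta_outer[of r] r(1) pr(3) by blast
    ultimately have "p \<in> Z \<longleftrightarrow> r \<in> Z" by (simp add: Z_def)
    moreover have "v \<inter> Z = {p, r} \<inter> Z" unfolding pr(1)[symmetric] x(2) using Z_fixed by blast
    moreover have "p \<noteq> r" using pr(2,3) by blast
    ultimately show ?thesis by (cases "p \<in> Z") simp_all
  qed
  moreover have "\<theta> ` Z \<subseteq> Z" by (auto simp: Z_def)
  ultimately have "Z \<in> even_sets" using Z_fixed fixed_subset by (auto simp: even_sets_def)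
  then obtain B where B: "B \<in> face_sets" "bd B = Z" using even_set_is_bd[OF plane] by blast
  have "Z \<noteq> {}" using qO by (auto simp: Z_def)
  then have "fixed \<subseteq> Z" using fixed_subset_bd[of B] B Z_fixed by simp
  show "fixed - A \<subseteq> ?O"
  proof
    fix d assume d: "d \<in> fixed - A"
    then have "d \<in> ?O \<or> \<theta> d \<in> ?O" using \<open>fixed \<subseteq> Z\<close> by (auto simp: Z_def)
    then show "d \<in> ?O" using sub theta_outer[OF d] by blast
  qed
qed

lemma outer_nonempty: "fixed - A \<noteq> {}"
proof -
  obtain x where "x \<in> fixed" using fixed_nonempty by blast
  then obtain q where "q \<in> fixed" "q \<notin> A" by (rule end_exists)
  then show ?thesis by blast
qed

lemma faces_half: "faces half = insert (fixed - A) (orbit fn ` A)"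
proof -
  have "orbit (face_next half) d = orbit fn d" if "d \<in> A" for d
    using that next_half_A by (intro orbit_cong_closed[of d A])
  then have "orbit (face_next half) ` A = orbit fn ` A" by (simp cong: image_cong)
  moreover have "orbit (face_next half) ` (fixed - A) = {fixed - A}"
    using outer_orbit outer_nonempty by (simp add: image_constant_conv)
  moreover have "C = A \<union> (fixed - A)" by (auto simp: C_def)
  then have "faces half = orbit (face_next half) ` A \<union> orbit (face_next half) ` (fixed - A)"
    unfolding faces_def half_simps(1) by (metis image_Un)
  ultimately show ?thesis by simp
qed

section \<open>Euler characteristic of the half\<close>

lemma card_A: "2 * card A = card D"
proof -
  have "bij_betw (\<lambda>d. \<phi> (\<theta> d)) A (D - A)"
  proof (rule bij_betw_byWitness[of _ "\<lambda>d. \<phi> (\<theta> d)"])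
    show "\<forall>a\<in>A. \<phi> (\<theta> (\<phi> (\<theta> a))) = a" "\<forall>a\<in>D - A. \<phi> (\<theta> (\<phi> (\<theta> a))) = a"
      using A_subset by (auto simp: phi_theta phi_in phi_phi)
    show "(\<lambda>d. \<phi> (\<theta> d)) ` A \<subseteq> D - A"
      using opposite A_subset phi_in theta_in by blast
    show "(\<lambda>d. \<phi> (\<theta> d)) ` (D - A) \<subseteq> A"
      using opposite by blast
  qed
  then have "card A = card (D - A)" by (rule bij_betw_same_card)
  moreover have "card (D - A) = card D - card A"
    using A_subset fin finite_subset by (intro card_Diff_subset) auto
  moreover have "card A \<le> card D" using A_subset fin by (intro card_mono)
  ultimately show ?thesis by simp
qed

lemma card_fixed: "card fixed = 2 * card (fixed - A)"
proof -
  have "bij_betw \<theta> (fixed - A) (fixed \<inter> A)"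
  proof (rule bij_betw_byWitness[of _ \<theta>])
    show "\<theta> ` (fixed \<inter> A) \<subseteq> fixed - A" using theta_A fixed_subset by auto
  qed (use theta_outer in auto)
  then have "card (fixed - A) = card (fixed \<inter> A)" by (rule bij_betw_same_card)
  moreover have "card fixed = card (fixed \<inter> A) + card (fixed - A)"
    using fixed_subset fin finite_subset by (intro card_Int_Diff) blast
  ultimately show ?thesis by simp
qed

lemma card_C: "2 * card C = card D + card fixed"
proof -
  have "C = A \<union> (fixed - A)" by (auto simp: C_def)
  then have "card C = card A + card (fixed - A)"
    using A_subset fixed_subset fin by (metis Diff_disjoint card_Un_disjoint finite_Diff finite_subset)
  then show ?thesis using card_A card_fixed by simp
qed

lemma phi_image_vx: "d \<in> D \<Longrightarrow> \<phi> ` vx d = vx (\<phi> d)"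
proof
  have sub: "\<phi> ` vx d \<subseteq> vx (\<phi> d)" if "d \<in> D" for d
    using phi_vx[OF that] vx_eq_iff by auto
  assume d: "d \<in> D"
  then show "\<phi> ` vx d \<subseteq> vx (\<phi> d)" by (rule sub)
  show "vx (\<phi> d) \<subseteq> \<phi> ` vx d"
  proof
    fix x assume x: "x \<in> vx (\<phi> d)"
    then have xD: "x \<in> D" using vx_subset[OF phi_in[OF d]] by blast
    have "\<phi> x \<in> vx d" using sub[OF phi_in[OF d]] x phi_phi[OF d] by auto
    then have "\<phi> (\<phi> x) \<in> \<phi> ` vx d" by (rule imageI)
    then show "x \<in> \<phi> ` vx d" using phi_phi[OF xD] by simp
  qed
qed

definition fixed_verts where "fixed_verts = {v \<in> vertices Op. v \<inter> fixed \<noteq> {}}"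
definition inner_verts where "inner_verts = {v \<in> vertices Op. v \<inter> fixed = {} \<and> v \<inter> A \<noteq> {}}"
definition mirror_verts where "mirror_verts = {v \<in> vertices Op. v \<inter> fixed = {} \<and> v \<inter> A = {}}"

lemma inner_subset: "v \<in> inner_verts \<Longrightarrow> v \<subseteq> A - fixed"
proof -
  assume v: "v \<in> inner_verts"
  then obtain d where d: "d \<in> A" "d \<in> v" "v \<in> vertices Op" "v \<inter> fixed = {}"
    by (auto simp: inner_verts_def)
  then have "v = vx d" "d \<in> D" using in_vertex_eq A_subset by blast+
  then show ?thesis using constant_off_fixed[of d] d by blast
qed

lemma card_inner_mirror: "card inner_verts = card mirror_verts"
proof -
  have image: "\<phi> ` v \<in> vertices Op \<and> \<phi> ` \<phi> ` v = v" if v: "v \<in> vertices Op" for v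
  proof -
    obtain d where d: "d \<in> D" "v = vx d" using v by (auto simp: vertices_def)
    then show ?thesis by (simp add: phi_image_vx phi_in phi_phi)
  qed
  have "bij_betw ((`) \<phi>) inner_verts mirror_verts"
  proof (rule bij_betw_byWitness[of _ "(`) \<phi>"])
    show "\<forall>v\<in>inner_verts. \<phi> ` \<phi> ` v = v" "\<forall>v\<in>mirror_verts. \<phi> ` \<phi> ` v = v"
      using image by (auto simp: inner_verts_def mirror_verts_def)
    show "(`) \<phi> ` inner_verts \<subseteq> mirror_verts"
    proof
      fix w assume "w \<in> (`) \<phi> ` inner_verts"
      then obtain v where v: "v \<in> inner_verts" "w = \<phi> ` v" by blast
      have "\<phi> x \<notin> fixed \<and> \<phi> x \<notin> A" if "x \<in> v" for x
      proof -
        have "x \<in> A" "x \<notin> fixed" "x \<in> D" using inner_subset[OF v(1)] that A_subset by blast+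
        then show ?thesis using phi_A phi_fixed_iff by blast
      qed
      then show "w \<in> mirror_verts"
        using v image[of v] by (auto simp: mirror_verts_def inner_verts_def)
    qed
    show "(`) \<phi> ` mirror_verts \<subseteq> inner_verts"
    proof
      fix w assume "w \<in> (`) \<phi> ` mirror_verts"
      then obtain v where v: "v \<in> mirror_verts" "w = \<phi> ` v" by blast
      then have vv: "v \<in> vertices Op" "v \<inter> fixed = {}" "v \<inter> A = {}" by (auto simp: mirror_verts_def)
      have *: "\<phi> x \<notin> fixed \<and> \<phi> x \<in> A" if "x \<in> v" for x
      proof -
        have "x \<notin> A" "x \<notin> fixed" "x \<in> D" using vv that vertex_subset by blast+
        then show ?thesis using phi_A phi_fixed_iff by blast
      qed
      obtain x where "x \<in> v" using vertex_nonempty[OF vv(1)] by blast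
      then show "w \<in> inner_verts"
        using * v(2) image[OF vv(1)] by (auto simp: inner_verts_def)
    qed
  qed
  then show ?thesis by (rule bij_betw_same_card)
qed

text \<open>Each vertex on the cycle has exactly two fixed darts, so the cycle has as many vertices
  as edges. In the Euler characteristic of the half, the two contributions cancel.\<close>

lemma card_fixed_verts: "card fixed = 2 * card fixed_verts"
proof -
  let ?P = "(\<lambda>v. v \<inter> fixed) ` fixed_verts"
  have disj: "v = w" if "v \<in> fixed_verts" "w \<in> fixed_verts" "x \<in> v" "x \<in> w" for v w x
  proof -
    have "v = vx x" "w = vx x" using that in_vertex_eq by (auto simp: fixed_verts_def)
    then show ?thesis by simp
  qed
  have "\<Union>?P = fixed"
  proof (intro subset_antisym subsetI)
    fix x assume "x \<in> fixed"
    then have "vx x \<in> fixed_verts" "x \<in> vx x \<inter> fixed"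
      using fixed_subset self_in_vx[of x] by (auto simp: fixed_verts_def simp del: self_in_vx)
    then show "x \<in> \<Union>?P" by blast
  qed auto
  moreover have "card (v \<inter> fixed) = 2" if v: "v \<in> fixed_verts" for v
  proof -
    obtain x where x: "x \<in> v" "x \<in> fixed" using v by (auto simp: fixed_verts_def)
    then show ?thesis using fixed_vertex_card[OF x(2)] in_vertex_eq[of v x] v by (simp add: fixed_verts_def)
  qed
  moreover have "card (\<Union>v\<in>fixed_verts. v \<inter> fixed) = (\<Sum>v\<in>fixed_verts. card (v \<inter> fixed))"
  proof (rule card_UN_disjoint)
    show "finite fixed_verts" using finite_vertices by (simp add: fixed_verts_def)
    show "\<forall>v\<in>fixed_verts. finite (v \<inter> fixed)" using vertex_finite by (auto simp: fixed_verts_def)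
    show "\<forall>v\<in>fixed_verts. \<forall>w\<in>fixed_verts. v \<noteq> w \<longrightarrow> (v \<inter> fixed) \<inter> (w \<inter> fixed) = {}"
      using disj by blast
  qed
  ultimately show ?thesis by simp
qed

lemma card_vertices: "card (vertices Op) = card fixed_verts + 2 * card inner_verts"
  and card_vertices_half: "card (vertices half) = card fixed_verts + card inner_verts"
proof -
  have fins: "finite fixed_verts" "finite inner_verts" "finite mirror_verts"
    using finite_vertices by (auto simp: fixed_verts_def inner_verts_def mirror_verts_def)
  have "vertices Op = fixed_verts \<union> (inner_verts \<union> mirror_verts)"
    by (auto simp: fixed_verts_def inner_verts_def mirror_verts_def)
  moreover have "card (fixed_verts \<union> (inner_verts \<union> mirror_verts)) =
      card fixed_verts + card (inner_verts \<union> mirror_verts)"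
    using fins by (intro card_Un_disjoint) (auto simp: fixed_verts_def inner_verts_def mirror_verts_def)
  moreover have "card (inner_verts \<union> mirror_verts) = card inner_verts + card mirror_verts"
    using fins by (intro card_Un_disjoint) (auto simp: inner_verts_def mirror_verts_def)
  ultimately show "card (vertices Op) = card fixed_verts + 2 * card inner_verts"
    using card_inner_mirror by simp
  have "{v \<in> vertices Op. v \<inter> C \<noteq> {}} = fixed_verts \<union> inner_verts"
    by (auto simp: fixed_verts_def inner_verts_def C_def)
  moreover have "card (fixed_verts \<union> inner_verts) = card fixed_verts + card inner_verts"
    using fins by (intro card_Un_disjoint) (auto simp: fixed_verts_def inner_verts_def)
  moreover have "inj_on (\<lambda>v. v \<inter> C) {v \<in> vertices Op. v \<inter> C \<noteq> {}}"
  proof (rule inj_onI)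
    fix v w assume v: "v \<in> {v \<in> vertices Op. v \<inter> C \<noteq> {}}" and w: "w \<in> {v \<in> vertices Op. v \<inter> C \<noteq> {}}"
      and "v \<inter> C = w \<inter> C"
    then obtain x where "x \<in> v" "x \<in> w" by blast
    then have "v = vx x" "w = vx x" using v w in_vertex_eq by auto
    then show "v = w" by simp
  qed
  ultimately show "card (vertices half) = card fixed_verts + card inner_verts"
    unfolding vertices_half by (simp add: card_image)
qed

text \<open>With f vertices and f edges on the fixed cycle, the half has (V+f)/2 vertices, (E+f)/2
  edges and F/2 + 1 faces, the additional one being the outer face. Its Euler characteristic is thus
  2/2 + 1 = 2.\<close>

lemma plane_half: "plane_map half"
proof -
  have "fixed - A \<notin> orbit fn ` A"
  proof
    assume "fixed - A \<in> orbit fn ` A"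
    then obtain d where "d \<in> A" "fixed - A = orbit fn d" by blast
    then show False using self_in_orbit_permutes[OF fin face_next_perm, of d] by blast
  qed
  moreover have "finite (orbit fn ` A)" using A_subset fin finite_subset by blast
  ultimately have F: "card (faces half) = card (orbit fn ` A) + 1" by (simp add: faces_half)
  have "3 * card (orbit fn ` A) = card A" using card_face_set[OF A] by simp
  then have F2: "2 * card (orbit fn ` A) = card (faces Op)" using card_A card_darts_faces by simp
  have E: "4 * card (edges half) = 2 * card (edges Op) + card fixed"
    using H.card_darts_edges card_darts_edges card_C by simp
  have "int (card (vertices Op)) - int (card (edges Op)) + int (card (faces Op)) = 2"
    using plane by (simp add: plane_map_def)
  then have "int (card (vertices half)) - int (card (edges half)) + int (card (faces half)) = 2"
    using F F2 E card_vertices card_vertices_half card_fixed_verts by linarith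
  then show ?thesis using half_is_map by (simp add: plane_map_def)
qed

section \<open>Colours and degrees in the half\<close>

lemma colour_half: "d \<in> C \<Longrightarrow> colour half (vx d \<inter> C) = col d"
proof -
  assume "d \<in> C"
  then have "d \<in> vx d \<inter> C" by simp
  then have "(SOME x. x \<in> vx d \<inter> C) \<in> vx d \<inter> C" by (rule someI)
  then have "vx (SOME x. x \<in> vx d \<inter> C) = vx d" using vx_eq by blast
  then show ?thesis unfolding half_simps(4) by simp
qed

lemma marked_half:
  assumes "v \<in> {v0 Op, v1 Op, v2 Op}"
  shows "v \<inter> C \<in> vertices half" "on_outer half (v \<inter> C)" "colour half (v \<inter> C) = colour Op v"
proof -
  obtain x where x: "x \<in> fixed" "v = vx x" using marked_meets_fixed[OF assms] .
  then have xC: "x \<in> C" by (simp add: C_def)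
  show "v \<inter> C \<in> vertices half"
    using H.vx_in_vertices[of x] xC vertex_of_half[OF xC] x(2) by simp
  show "colour half (v \<inter> C) = colour Op v" using colour_half[OF xC] x(2) by simp
  obtain q where "q \<in> fixed" "q \<notin> A" "vx q = vx x" using end_exists[OF x(1)] .
  then have "q \<in> v \<inter> C \<inter> (fixed - A)" using x(2) self_in_vx[of q] by (auto simp: C_def simp del: self_in_vx)
  then show "on_outer half (v \<inter> C)" unfolding on_outer_def by auto
qed

lemma Int_C_cancel:
  assumes "v \<in> vertices Op" "w \<in> vertices Op" "v \<inter> C = w \<inter> C" "v \<inter> C \<noteq> {}"
  shows "v = w"
proof -
  obtain x where "x \<in> v" "x \<in> w" using assms(3,4) by blast
  then have "v = vx x" "w = vx x" using in_vertex_eq assms(1,2) by auto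
  then show ?thesis by simp
qed

lemma marked_half_distinct: "distinct [v0 half, v1 half, v2 half]"
proof -
  have "v \<inter> C \<noteq> w \<inter> C" if "v \<in> {v0 Op, v1 Op, v2 Op}" "w \<in> {v0 Op, v1 Op, v2 Op}" "v \<noteq> w" for v w
    using Int_C_cancel[of v w] that marked_in H.vertex_nonempty[OF marked_half(1)[OF that(1)]] by auto
  then show ?thesis using marked_distinct by simp
qed

lemma coloured_half: "coloured_and_marked half"
proof -
  have op: "colour Op (v0 Op) \<noteq> 1" "colour Op (v2 Op) \<noteq> 1" "colour Op (v1 Op) = 1 \<longrightarrow> card (v1 Op) = 2"
    using lopsp by (auto simp: lopsp_operation_def coloured_and_marked_def)
  have "colour half v \<in> {0, 1, 2}" if v: "v \<in> vertices half" for v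
  proof -
    obtain d where d: "d \<in> C" "v = vx d \<inter> C" using half_vertexE[OF v] .
    have "colour half v = col d" using colour_half[OF d(1)] d(2) by simp
    then show ?thesis using col_range[of d] d(1) C_subset by auto
  qed
  moreover have "colour half (vertex_of half d) \<noteq> colour half (vertex_of half (theta half d))"
    if "d \<in> darts half" for d
  proof -
    have d: "d \<in> C" "\<theta> d \<in> C" "d \<in> D" using that C_subset by auto
    have "colour half (vertex_of half d) = col d"
      using vertex_of_half[OF d(1)] colour_half[OF d(1)] by simp
    moreover have "colour half (vertex_of half (theta half d)) = col (\<theta> d)"
      using vertex_of_half[OF d(2)] colour_half[OF d(2)] d(1) by simp
    ultimately show ?thesis using col_theta[OF d(3)] by simp
  qed
  moreover have "card (v1 half) = 2" if "colour half (v1 half) = 1"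
  proof -
    have "card (v1 Op) = 2" using that marked_half(3)[of "v1 Op"] op(3) by simp
    obtain x where x: "x \<in> fixed" "v1 Op = vx x" using marked_meets_fixed by blast
    \<comment> \<open>A fixed vertex of degree 2 has only fixed darts, so it lies entirely in
      \<open>C\<close> and keeps its degree.\<close>
    have "v1 Op \<inter> fixed = v1 Op"
      using fixed_vertex_card[OF x(1)] \<open>card (v1 Op) = 2\<close> x(2) vertex_finite[OF marked_in(2)]
      by (metis Int_lower1 card_subset_eq)
    then have "v1 Op \<inter> C = v1 Op" by (auto simp: C_def)
    then show ?thesis using \<open>card (v1 Op) = 2\<close> by simp
  qed
  moreover have "v0 half \<in> vertices half" "v1 half \<in> vertices half" "v2 half \<in> vertices half"
    "colour half (v0 half) \<noteq> 1" "colour half (v2 half) \<noteq> 1"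
    using marked_half(1,3) op by (simp_all del: half_simps(4))
  ultimately show ?thesis
    using marked_half_distinct unfolding coloured_and_marked_def by blast
qed

lemma phi_maps_fixed_vertex: "x \<in> fixed \<Longrightarrow> \<phi> ` vx x = vx x"
  using phi_image_vx[of x] by (simp add: fixed_def)

text \<open>Two of the four darts are fixed, hence in \<open>C\<close>. The reflection exchanges the
  darts outside \<open>C\<close> with the unfixed ones in \<open>C\<close>, so there is one of
  each.\<close>

lemma card_boundary_vertex:
  assumes "x \<in> fixed" "card (vx x) = 4"
  shows "card (vx x \<inter> C) = 3"
proof -
  have xD: "x \<in> D" using assms(1) fixed_subset by blast
  have fv: "finite (vx x)" using vx_subset[OF xD] fin finite_subset by blast
  have in_vx: "\<phi> y \<in> vx x" if "y \<in> vx x" for y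
    using that phi_maps_fixed_vertex[OF assms(1)] by blast
  have yD: "y \<in> D" if "y \<in> vx x" for y using that vx_subset[OF xD] by blast
  have "bij_betw \<phi> (vx x - C) (vx x \<inter> C - fixed)"
  proof (rule bij_betw_byWitness[of _ \<phi>])
    show "\<forall>a\<in>vx x - C. \<phi> (\<phi> a) = a" "\<forall>a\<in>vx x \<inter> C - fixed. \<phi> (\<phi> a) = a"
      using yD phi_phi by blast+
    show "\<phi> ` (vx x - C) \<subseteq> vx x \<inter> C - fixed"
    proof (rule image_subsetI)
      fix y assume y: "y \<in> vx x - C"
      then have "y \<notin> fixed" by (simp add: C_def)
      then show "\<phi> y \<in> vx x \<inter> C - fixed" using y in_vx[of y] phi_C[OF yD[of y]] phi_fixed_iff[OF yD[of y]] by simp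
    qed
    show "\<phi> ` (vx x \<inter> C - fixed) \<subseteq> vx x - C"
    proof (rule image_subsetI)
      fix y assume y: "y \<in> vx x \<inter> C - fixed"
      then show "\<phi> y \<in> vx x - C" using in_vx[of y] phi_C[OF yD[of y]] by simp
    qed
  qed
  then have "card (vx x - C) = card (vx x \<inter> C - fixed)" by (rule bij_betw_same_card)
  moreover have "card (vx x) = card (vx x \<inter> C) + card (vx x - C)" using fv by (rule card_Int_Diff)
  moreover have "card (vx x \<inter> C) = card (vx x \<inter> C \<inter> fixed) + card (vx x \<inter> C - fixed)"
    using fv by (intro card_Int_Diff) simp
  moreover have "vx x \<inter> C \<inter> fixed = vx x \<inter> fixed" by (auto simp: C_def)
  ultimately show ?thesis using fixed_vertex_card[OF assms(1)] assms(2) by simp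
qed

lemma card_colour_1_half:
  assumes "d \<in> C" "col d = 1"
  shows "vx d \<inter> fixed = {} \<Longrightarrow> card (vx d \<inter> C) = 4"
    and "vx d \<inter> fixed \<noteq> {} \<Longrightarrow> vx d \<inter> C \<notin> {v0 half, v1 half, v2 half} \<Longrightarrow> card (vx d \<inter> C) = 3"
proof -
  have dD: "d \<in> D" using assms(1) C_subset by blast
  have four: "card (vx d) = 4" if "vx d \<notin> {v0 Op, v1 Op, v2 Op}"
    using that lopsp dD assms(2) by (simp add: lopsp_operation_def)
  show "card (vx d \<inter> C) = 4" if empty: "vx d \<inter> fixed = {}"
  proof -
    have "vx d \<notin> {v0 Op, v1 Op, v2 Op}"
    proof
      assume "vx d \<in> {v0 Op, v1 Op, v2 Op}"
      then obtain x where "x \<in> fixed" "vx d = vx x" by (rule marked_meets_fixed)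
      then show False using empty self_in_vx[of x] by auto
    qed
    moreover have "vx d \<subseteq> C"
    proof -
      have "d \<notin> fixed" using empty self_in_vx[of d] by blast
      then have "d \<in> A" using assms(1) by (simp add: C_def)
      then show ?thesis using constant_off_fixed[OF dD empty] unfolding C_def by blast
    qed
    ultimately show ?thesis using four by (simp add: Int_absorb2)
  qed
  show "card (vx d \<inter> C) = 3" if meets: "vx d \<inter> fixed \<noteq> {}" and nv: "vx d \<inter> C \<notin> {v0 half, v1 half, v2 half}"
  proof -
    obtain x where x: "x \<in> vx d" "x \<in> fixed" using meets by blast
    have "vx d \<notin> {v0 Op, v1 Op, v2 Op}" using nv by auto
    then show ?thesis using card_boundary_vertex[OF x(2)] vx_eq[OF x(1)] four by simp
  qed
qed

lemma on_outer_half: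
  assumes "d \<in> C"
  shows "on_outer half (vx d \<inter> C) \<longleftrightarrow> vx d \<inter> fixed \<noteq> {}"
proof
  assume "vx d \<inter> fixed \<noteq> {}"
  then obtain x where x: "x \<in> vx d" "x \<in> fixed" by blast
  obtain q where q: "q \<in> fixed" "q \<notin> A" "vx q = vx x" using end_exists[OF x(2)] .
  then have "q \<in> vx d" using vx_eq[OF x(1)] vx_eq_iff by simp
  then show "on_outer half (vx d \<inter> C)" using q by (auto simp: on_outer_def C_def)
qed (auto simp: on_outer_def)

section \<open>The half is 2-connected\<close>

text \<open>
  Consecutive neighbours of \<open>v\<close> are joined by the third edge of a triangle, except at the outer
  corner.
\<close>

lemma neighbours_connected:
  assumes v: "v \<in> vertices half"
    and closed: "\<And>a. a \<in> C \<Longrightarrow> vertex_of half a \<noteq> v \<Longrightarrow> vertex_of half (\<theta> a) \<noteq> v \<Longrightarrow>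
      vertex_of half a \<in> S \<longleftrightarrow> vertex_of half (\<theta> a) \<in> S"
    and "x \<in> v" "y \<in> v"
  shows "vertex_of half (\<theta> x) \<in> S \<longleftrightarrow> vertex_of half (\<theta> y) \<in> S"
proof -
  obtain d where d: "d \<in> C" "v = vx d \<inter> C" using half_vertexE[OF v] .
  \<comment> \<open>\<open>q\<close> is the dart before the outer corner; at a vertex with no such
    corner any dart will do.\<close>
  obtain q where q: "q \<in> v" "\<And>z. z \<in> v \<Longrightarrow> z \<noteq> q \<Longrightarrow> z \<in> A"
  proof (cases "v \<subseteq> A")
    case True
    moreover have "d \<in> v" using d self_in_vx[of d] by blast
    ultimately show ?thesis using that by blast
  next
    case False
    then obtain q where q: "q \<in> v" "q \<notin> A" by blast
    have "z \<in> A" if z: "z \<in> v" "z \<noteq> q" for z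
    proof (rule ccontr)
      assume "z \<notin> A"
      then have "z \<in> fixed" "q \<in> fixed" using z q d(2) by (auto simp: C_def)
      moreover have "vx z = vx d" "vx q = vx d" using z(1) q(1) d(2) vx_eq by auto
      ultimately show False using end_unique[of z q] \<open>z \<notin> A\<close> q(2) z(2) by simp
    qed
    then show ?thesis using that q by blast
  qed
  have "v = vertex_of half q" using H.in_vertex_eq[OF v q(1)] .
  then have orbit: "orbit sig q = v" by (simp add: vertex_of_def)
  let ?P = "\<lambda>z. vertex_of half (\<theta> z) \<in> S"
  have step: "?P (sig z) = ?P z" if z: "z \<in> orbit sig q" "z \<noteq> q" for z
  proof -
    have zv: "z \<in> v" "z \<in> A" using z q orbit by auto
    have zD: "z \<in> D" using zv A_subset by blast
    \<comment> \<open>The side opposite \<open>v\<close> in the triangle to the left of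
      \<open>z\<close>. It joins the ends of \<open>z\<close> and \<open>\<sigma> z\<close>, and
      both have colours different from that of \<open>v\<close>, so this edge survives the deletion
      of \<open>v\<close>.\<close>
    let ?a = "fn z"
    have aA: "?a \<in> A" using next_half_A(2)[OF zv(2)] .
    then have "?a \<in> C" by (simp add: C_def)
    then have aC: "?a \<in> C" "\<theta> ?a \<in> C" by simp_all
    have zC: "z \<in> C" "\<theta> z \<in> C" using zv(2) theta_C[of z] unfolding C_def by blast+
    have sz: "sig z = \<sigma> z" using zv by (simp add: sig_def)
    have "sig z \<in> C" using sig_C[OF zC(1)] .
    then have szC: "\<sigma> z \<in> C" using sz by simp
    have v_vx: "v = vx z \<inter> C" using vx_eq zv(1) d(2) by auto
    have a1: "vertex_of half ?a = vertex_of half (\<theta> z)"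
      using vertex_of_half[OF aC(1)] vertex_of_half[OF zC(2)] by simp
    have "vx (\<theta> ?a) = vx (\<theta> (\<sigma> z))" using fn_fn[OF zD] vx_face_next[of ?a] by simp
    then have a2: "vertex_of half (\<theta> ?a) = vertex_of half (\<theta> (\<sigma> z))"
      using vertex_of_half[OF aC(2)] vertex_of_half[of "\<theta> (\<sigma> z)"] szC by simp
    have "vertex_of half e \<noteq> v" if "e \<in> C" "col e \<noteq> col z" for e
    proof
      assume "vertex_of half e = v"
      then have "vx e \<inter> C = vx z \<inter> C" using vertex_of_half[OF that(1)] v_vx by simp
      then have "e \<in> vx z" using that(1) self_in_vx[of e] by blast
      then show False using vx_eq[of e z] that(2) by simp
    qed
    then have "vertex_of half ?a \<noteq> v" "vertex_of half (\<theta> ?a) \<noteq> v"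
      using a1 a2 col_theta[OF zD] third_colour(1)[OF zD] zC szC
        vertex_of_half[OF aC(1)] vertex_of_half[OF aC(2)] by simp_all
    then show ?thesis using closed[OF aC(1)] a1 a2 sz by simp
  qed
  have "?P x = ?P (sig q)" "?P y = ?P (sig q)"
    using orbit_constant[of x sig q ?P] orbit_constant[of y sig q ?P] step assms(3,4) orbit by auto
  then show ?thesis by simp
qed

text \<open>The neighbours of \<open>v\<close> are all in \<open>S\<close> or all outside it. Adding
  \<open>v\<close> to \<open>S\<close> in the first case gives a set that no edge of the half
  leaves, and the half itself is connected.\<close>

lemma half_minus_vertex_connected:
  assumes v: "v \<in> vertices half" and card: "3 \<le> card (vertices half)"
  shows "connected (pre_digraph.del_vert (underlying_graph half) v)"
proof -
  let ?G = "pre_digraph.del_vert (underlying_graph half) v"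
  have G: "verts ?G = vertices half - {v}"
    "arcs ?G = {a \<in> C. vertex_of half a \<noteq> v \<and> vertex_of half (theta half a) \<noteq> v}"
    "tail ?G = vertex_of half" "head ?G = (\<lambda>a. vertex_of half (theta half a))"
    by (simp_all add: pre_digraph.del_vert_simps underlying_graph_def)
  have iff: "connected ?G \<longleftrightarrow> verts ?G \<noteq> {} \<and> (\<forall>S\<subseteq>verts ?G. S \<noteq> {} \<longrightarrow>
      (\<forall>a\<in>arcs ?G. tail ?G a \<in> S \<longleftrightarrow> head ?G a \<in> S) \<longrightarrow> S = verts ?G)"
  proof (rule connected_iff_no_closed_set)
    fix a assume "a \<in> arcs ?G"
    then have a: "a \<in> C" "vertex_of half a \<noteq> v" "vertex_of half (theta half a) \<noteq> v" by (auto simp: G)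
    then show "tail ?G a \<in> verts ?G \<and> head ?G a \<in> verts ?G"
      using H.vx_in_vertices[of a] H.vx_in_vertices[of "theta half a"] unfolding G by simp
  qed
  have "verts ?G \<noteq> {}"
  proof
    assume "verts ?G = {}"
    then have "vertices half \<subseteq> {v}" by (auto simp: G)
    then have "card (vertices half) \<le> card {v}" by (intro card_mono) auto
    then show False using card by simp
  qed
  moreover have "S = verts ?G"
    if S: "S \<subseteq> verts ?G" "S \<noteq> {}" and cl: "\<forall>a\<in>arcs ?G. tail ?G a \<in> S \<longleftrightarrow> head ?G a \<in> S" for S
  proof -
    have S': "S \<subseteq> vertices half" "v \<notin> S" using S(1) by (auto simp: G)
    have closed: "vertex_of half a \<in> S \<longleftrightarrow> vertex_of half (\<theta> a) \<in> S"
      if "a \<in> C" "vertex_of half a \<noteq> v" "vertex_of half (\<theta> a) \<noteq> v" for a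
      using bspec[OF cl, of a] that by (simp add: G)
    have nb: "vertex_of half (\<theta> x) \<in> S \<longleftrightarrow> vertex_of half (\<theta> y) \<in> S" if "x \<in> v" "y \<in> v" for x y
      using neighbours_connected[OF v closed that] by blast
    obtain x where x: "x \<in> v" using H.vertex_nonempty[OF v] by blast
    define S2 where "S2 = (if vertex_of half (\<theta> x) \<in> S then insert v S else S)"
    have S2: "vertex_of half (\<theta> a) \<in> S2" if "a \<in> C" "vertex_of half a \<in> S2" for a
    proof -
      consider "vertex_of half a = v" | "vertex_of half (\<theta> a) = v" "vertex_of half a \<noteq> v"
        | "vertex_of half a \<noteq> v" "vertex_of half (\<theta> a) \<noteq> v" by blast
      then show ?thesis
      proof cases
        case 1
        then have "a \<in> v" using H.self_in_vx[of a] by simp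
        moreover have "vertex_of half (\<theta> x) \<in> S"
          using 1 that(2) S'(2) by (auto simp: S2_def split: if_splits)
        ultimately show ?thesis using nb[OF x, of a] by (simp add: S2_def)
      next
        case 2
        then have "\<theta> a \<in> v" using H.self_in_vx[of "\<theta> a"] by simp
        moreover have "vertex_of half a \<in> S" using 2 that(2) by (auto simp: S2_def split: if_splits)
        ultimately have "vertex_of half (\<theta> x) \<in> S" using nb[OF x, of "\<theta> a"] by simp
        then show ?thesis using 2 by (simp add: S2_def)
      next
        case 3
        then show ?thesis using closed[OF that(1)] that(2) by (auto simp: S2_def split: if_splits)
      qed
    qed
    have "{d \<in> C. vertex_of half d \<in> S2} = H.D"
    proof (rule H.darts_connected)
      obtain w where w: "w \<in> S" using S(2) by blast
      then obtain d where "d \<in> C" "w = vertex_of half d" using S'(1) by (auto simp: vertices_def)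
      then have "d \<in> {d \<in> C. vertex_of half d \<in> S2}" using w by (auto simp: S2_def)
      then show "{d \<in> C. vertex_of half d \<in> S2} \<noteq> {}" by blast
      fix d assume d: "d \<in> {d \<in> C. vertex_of half d \<in> S2}"
      then show "H.\<theta> d \<in> {d \<in> C. vertex_of half d \<in> S2}" using S2[of d] by simp
      show "H.\<sigma> d \<in> {d \<in> C. vertex_of half d \<in> S2}" using d H.vx_sigma[of d] H.sigma_in[of d] by simp
    qed simp
    then have "vertices half \<subseteq> S2" by (auto simp: vertices_def)
    then have "v \<in> S2" and "vertices half - {v} \<subseteq> S" using v by (auto simp: S2_def split: if_splits)
    then show ?thesis using S(1) by (simp add: G)
  qed
  ultimately show ?thesis unfolding iff by blast
qed

lemma two_connected_half: "two_connected half"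
proof -
  have sub: "{v0 half, v1 half, v2 half} \<subseteq> vertices half"
    using coloured_half by (simp add: coloured_and_marked_def)
  have "card {v0 half, v1 half, v2 half} = 3" using marked_half_distinct by (simp del: half_simps)
  then have "3 \<le> card (vertices half)" using card_mono[OF H.finite_vertices sub] by simp
  then show ?thesis
    using half_minus_vertex_connected H.graph_connected by (simp add: two_connected_def)
qed

lemma lsp_half: "lsp_operation half"
proof -
  have "card f = 3" if "f \<in> faces half - {outer half}" for f
    using that card_orbit_fn A_subset by (auto simp: faces_half)
  moreover have "card v = 4" if v: "v \<in> vertices half" "\<not> on_outer half v" "colour half v = 1" for v
  proof -
    obtain d where d: "d \<in> C" "v = vx d \<inter> C" using half_vertexE[OF v(1)] .
    then show ?thesis
      using card_colour_1_half(1)[OF d(1)] on_outer_half[OF d(1)] colour_half[OF d(1)] v(2,3)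
      by (simp del: half_simps)
  qed
  moreover have "card v = 3"
    if v: "v \<in> vertices half - {v0 half, v1 half, v2 half}" "on_outer half v" "colour half v = 1" for v
  proof -
    have "v \<in> vertices half" using v(1) by blast
    then obtain d where d: "d \<in> C" "v = vx d \<inter> C" by (rule half_vertexE)
    then show ?thesis
      using card_colour_1_half(2)[OF d(1)] on_outer_half[OF d(1)] colour_half[OF d(1)] v
      by (simp del: half_simps)
  qed
  moreover have "outer half \<in> faces half" by (simp add: faces_half)
  moreover have "on_outer half (v0 half)" "on_outer half (v1 half)" "on_outer half (v2 half)"
    using marked_half(2) by simp_all
  ultimately show ?thesis
    using plane_half two_connected_half coloured_half unfolding lsp_operation_def by blast
qed

end

section \<open>Gluing the half to its mirror image\<close>

context lopsp_cut
begin

definition glue where "glue p = (if snd p then \<phi> (fst p) else fst p)"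

lemma boundary_half: "boundary_darts half = fixed"
proof -
  have "x \<in> fixed \<longleftrightarrow> x \<in> (fixed - A) \<union> \<theta> ` (fixed - A)" for x
  proof
    assume x: "x \<in> fixed"
    show "x \<in> (fixed - A) \<union> \<theta> ` (fixed - A)"
    proof (cases "x \<in> A")
      case True
      then have "\<theta> x \<in> fixed - A" using x theta_A fixed_subset by auto
      then have "\<theta> (\<theta> x) \<in> \<theta> ` (fixed - A)" by (rule imageI)
      then show ?thesis by simp
    qed (use x in simp)
  qed auto
  moreover have "theta half ` (fixed - A) = \<theta> ` (fixed - A)"
  proof (rule image_cong[OF refl])
    fix x assume "x \<in> fixed - A"
    then have "x \<in> C" by (simp add: C_def)
    then show "theta half x = \<theta> x" by simp
  qed
  ultimately show ?thesis unfolding boundary_darts_def half_simps(8) by blast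
qed

lemma double_half_iff: "(d, b) \<in> double_darts half \<longleftrightarrow> d \<in> C \<and> (b \<longrightarrow> d \<notin> fixed)"
  by (auto simp: double_darts_def boundary_half)

lemma glue_mirror: "d \<in> C \<Longrightarrow> glue (mirror_dart half d) = \<phi> d"
  by (auto simp: glue_def mirror_dart_def boundary_half fixed_def)

lemma glue_in: "p \<in> double_darts half \<Longrightarrow> glue p \<in> D"
  using C_subset phi_in by (cases p) (auto simp: glue_def double_half_iff)

lemma glue_inj: "inj_on glue (double_darts half)"
proof (rule inj_onI)
  fix p q assume p: "p \<in> double_darts half" and q: "q \<in> double_darts half" and eq: "glue p = glue q"
  \<comment> \<open>The mirrored copy contains no fixed darts, so its image avoids the image
    \<open>C\<close> of the first copy.\<close>
  have phi_notin: "\<phi> d \<notin> C" if "(d, True) \<in> double_darts half" for d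
    using that phi_C[of d] C_subset by (auto simp: double_half_iff)
  obtain d b e c where de: "p = (d, b)" "q = (e, c)" by (metis surj_pair)
  have CD: "d \<in> C" "e \<in> C" "d \<in> D" "e \<in> D" using p q de C_subset by (auto simp: double_half_iff)
  have "b = c" using p q eq phi_notin CD de by (cases b; cases c) (auto simp: glue_def)
  moreover have "d = e" using eq de \<open>b = c\<close> phi_inj[OF CD(3,4)] by (cases b) (auto simp: glue_def)
  ultimately show "p = q" using de by simp
qed

lemma glue_surj:
  assumes "x \<in> D"
  obtains p where "p \<in> double_darts half" "glue p = x" "fst p = x \<or> fst p = \<phi> x"
proof (cases "x \<in> C")
  case True
  then show ?thesis using that[of "(x, False)"] by (simp add: double_half_iff glue_def)
next
  case False
  then have "x \<notin> fixed" by (simp add: C_def)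
  then have "(\<phi> x, True) \<in> double_darts half"
    using False phi_C[OF assms] phi_fixed_iff[OF assms] by (simp add: double_half_iff)
  then show ?thesis using that[of "(\<phi> x, True)"] phi_phi[OF assms] by (simp add: glue_def)
qed

lemma glue_theta: "p \<in> double_darts half \<Longrightarrow> glue (double_theta half p) = \<theta> (glue p)"
  using C_subset phi_theta by (cases p) (auto simp: double_theta_def double_half_iff glue_def)

lemma inv_sig_C: "d \<in> C \<Longrightarrow> inv sig d \<in> C"
  using H.sigma_inv_in[of d] by simp

lemma double_sigma_half_in: "p \<in> double_darts half \<Longrightarrow> double_sigma half p \<in> double_darts half"
  using sig_C inv_sig_C
  by (cases p) (auto simp: double_sigma_def double_half_iff mirror_dart_def boundary_half)

text \<open>Outside the first case the dart is mirrored or closes a sector. Either way its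
  predecessor \<open>inv \<sigma> d\<close> is in \<open>A\<close>, where \<open>sig\<close> and
  \<open>\<sigma>\<close> agree, and \<open>\<phi>\<close> turns this backward step into a forward
  one. A closing dart is fixed, which makes the passage to the mirror image seamless.\<close>

lemma glue_sigma:
  assumes p: "p \<in> double_darts half"
  shows "glue (double_sigma half p) = \<sigma> (glue p)"
proof -
  obtain d b where db: "p = (d, b)" by fastforce
  have d: "d \<in> C" "d \<in> D" using p db C_subset by (auto simp: double_half_iff)
  show ?thesis
  proof (cases "\<not> b \<and> d \<in> A")
    case True
    then show ?thesis using p db by (simp add: double_sigma_def glue_def sig_def)
  next
    case False
    then have s: "double_sigma half p = mirror_dart half (inv sig d)"
      using p db d(1) by (auto simp: double_sigma_def C_def)
    have "inv \<sigma> d \<in> A"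
      using False sigma_inv_A[OF d(2)] p db by (auto simp: double_half_iff C_def)
    then have "sig (inv \<sigma> d) = d" by (simp add: sig_def)
    then have "inv sig d = inv \<sigma> d" using H.sigma_inv(2)[of "inv \<sigma> d"] by simp
    then have "glue (double_sigma half p) = \<sigma> (\<phi> d)"
      using s glue_mirror[OF inv_sig_C[OF d(1)]] phi_sigma_inv[OF d(2)] by simp
    moreover have "\<phi> d = glue p"
      using False d(1) db by (cases b) (auto simp: glue_def C_def fixed_def)
    ultimately show ?thesis by simp
  qed
qed

lemma glue_orbit:
  assumes p: "p \<in> double_darts half"
  shows "glue ` orbit (double_sigma half) p = vx (glue p)"
proof -
  let ?s = "double_sigma half"
  have fwd: "x \<in> double_darts half \<and> glue x \<in> orbit \<sigma> (glue p)" if "x \<in> orbit ?s p" for x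
    using that
  proof (induction rule: orbit.induct)
    case base
    then show ?case using p double_sigma_half_in glue_sigma by (simp add: orbit.base)
  next
    case (step y)
    then show ?case using double_sigma_half_in glue_sigma by (simp add: orbit.step)
  qed
  have "\<exists>x\<in>orbit ?s p. glue x = y" if "y \<in> orbit \<sigma> (glue p)" for y
    using that
  proof (induction rule: orbit.induct)
    case base
    then show ?case using glue_sigma[OF p] orbit.base[of ?s p] by blast
  next
    case (step y)
    then obtain x where "x \<in> orbit ?s p" "glue x = y" by blast
    then show ?case using fwd glue_sigma[of x] orbit.step[of x ?s p] by blast
  qed
  then show ?thesis using fwd unfolding vertex_of_def by blast
qed

lemma col_glue: "p \<in> double_darts half \<Longrightarrow> col (glue p) = col (fst p)"
  using col_phi C_subset by (cases p) (auto simp: glue_def double_half_iff)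

text \<open>The colour of \<open>v\<close> is read off at an arbitrary element of its first
  projection. That element is \<open>fst r\<close> for some \<open>r\<close> in \<open>v\<close>,
  and \<open>glue r\<close> is \<open>fst r\<close> or its image under \<open>\<phi>\<close>, which
  preserves colours.\<close>

lemma glue_colour:
  assumes "v \<in> vertices (lopsp_of_lsp half)"
  shows "colour Op (glue ` v) = colour (lopsp_of_lsp half) v"
proof -
  obtain p where p: "p \<in> double_darts half" "v = orbit (double_sigma half) p"
    using assms by (auto simp: vertices_def vertex_of_def lopsp_of_lsp_def)
  have image: "glue ` v = vx (glue p)" using glue_orbit[OF p(1)] p(2) by simp
  have v_sub: "r \<in> double_darts half" if "r \<in> v" for r
    using that unfolding p(2)
    by (induction rule: orbit.induct) (use p(1) double_sigma_half_in in blast)+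
  have "fst (double_sigma half p) \<in> fst ` v"
    unfolding p(2) by (intro imageI orbit.base)
  then have "(SOME d. d \<in> fst ` v) \<in> fst ` v" by (rule someI)
  then obtain r where r: "r \<in> v" "(SOME d. d \<in> fst ` v) = fst r" by blast
  have "glue r \<in> vx (glue p)" using r(1) image by blast
  then have "vx (glue r) = vx (glue p)" by (rule vx_eq)
  moreover have "col (glue r) = col (fst r)" using col_glue v_sub[OF r(1)] by blast
  moreover have "colour (lopsp_of_lsp half) v = col (SOME d. d \<in> fst ` v)"
    by (simp add: lopsp_of_lsp_def)
  ultimately show ?thesis using image r(2) by simp
qed

lemma glue_marked:
  assumes "v \<in> {v0 Op, v1 Op, v2 Op}"
  shows "glue ` {p \<in> double_darts half. fst p \<in> v \<inter> C} = v"
proof -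
  obtain x where x: "x \<in> fixed" "v = vx x" using marked_meets_fixed[OF assms] .
  have \<phi>v: "\<phi> y \<in> v" if "y \<in> v" for y using phi_maps_fixed_vertex[OF x(1)] x(2) that by blast
  show ?thesis
  proof (intro subset_antisym subsetI)
    fix y assume "y \<in> glue ` {p \<in> double_darts half. fst p \<in> v \<inter> C}"
    then obtain p where "fst p \<in> v" "y = glue p" by blast
    then show "y \<in> v" using \<phi>v by (cases "snd p") (simp_all add: glue_def)
  next
    fix y assume y: "y \<in> v"
    then have "y \<in> D" using vx_subset[of x] x fixed_subset by blast
    then obtain p where p: "p \<in> double_darts half" "glue p = y" "fst p = y \<or> fst p = \<phi> y"
      by (rule glue_surj)
    have "fst p \<in> v" using p(3) y \<phi>v by auto
    moreover have "fst p \<in> C" using p(1) by (cases p) (auto simp: double_half_iff)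
    ultimately have "fst p \<in> v \<inter> C" by blast
    then show "y \<in> glue ` {p \<in> double_darts half. fst p \<in> v \<inter> C}" using p by blast
  qed
qed

lemma glue_iso: "marked_map_iso glue (lopsp_of_lsp half) Op"
proof -
  have "glue ` double_darts half = D"
  proof
    show "glue ` double_darts half \<subseteq> D" using glue_in by blast
    show "D \<subseteq> glue ` double_darts half"
    proof
      fix x assume "x \<in> D"
      then obtain p where "p \<in> double_darts half" "glue p = x" by (rule glue_surj)
      then show "x \<in> glue ` double_darts half" by blast
    qed
  qed
  then have "bij_betw glue (darts (lopsp_of_lsp half)) D"
    using glue_inj by (simp add: bij_betw_def lopsp_of_lsp_def)
  moreover have "\<forall>p\<in>darts (lopsp_of_lsp half).
      glue (theta (lopsp_of_lsp half) p) = \<theta> (glue p) \<and> glue (sigma (lopsp_of_lsp half) p) = \<sigma> (glue p)"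
    using glue_theta glue_sigma by (simp add: lopsp_of_lsp_def)
  moreover have "glue ` v0 (lopsp_of_lsp half) = v0 Op" "glue ` v1 (lopsp_of_lsp half) = v1 Op"
    "glue ` v2 (lopsp_of_lsp half) = v2 Op"
    using glue_marked[of "v0 Op"] glue_marked[of "v1 Op"] glue_marked[of "v2 Op"]
    by (simp_all add: lopsp_of_lsp_def)
  ultimately show ?thesis using glue_colour unfolding marked_map_iso_def by blast
qed

end

lemma (in lopsp_reflection) written_as_lsp: "can_be_written_as_lsp Op"
proof -
  obtain A where A: "A \<in> face_sets" "bd A = fixed" using even_set_is_bd[OF plane fixed_even] .
  interpret lopsp_cut Op \<phi> A by unfold_locales (rule A)+
  show ?thesis unfolding can_be_written_as_lsp_def using lsp_half glue_iso by blast
qed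

theorem theorem12:
  fixes Op :: "'a marked_map"
  assumes "lopsp_operation Op"
  shows "can_be_written_as_lsp Op \<longleftrightarrow>
    (\<exists>\<phi>. orientation_reversing_automorphism Op \<phi> \<and>
         fixes_vertex \<phi> (v0 Op) \<and> fixes_vertex \<phi> (v1 Op) \<and> fixes_vertex \<phi> (v2 Op))"
proof
  assume "can_be_written_as_lsp Op"
  then obtain L :: "'a lsp_map" and h where "lsp_operation L" "marked_map_iso h (lopsp_of_lsp L) Op"
    by (auto simp: can_be_written_as_lsp_def)
  then interpret lsp_double L Op h using assms by unfold_locales
  show "\<exists>\<phi>. orientation_reversing_automorphism Op \<phi> \<and>
      fixes_vertex \<phi> (v0 Op) \<and> fixes_vertex \<phi> (v1 Op) \<and> fixes_vertex \<phi> (v2 Op)"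
    by (rule reflection_exists)
next
  assume "\<exists>\<phi>. orientation_reversing_automorphism Op \<phi> \<and>
      fixes_vertex \<phi> (v0 Op) \<and> fixes_vertex \<phi> (v1 Op) \<and> fixes_vertex \<phi> (v2 Op)"
  then obtain \<phi> where "orientation_reversing_automorphism Op \<phi>" "fixes_vertex \<phi> (v0 Op)"
      "fixes_vertex \<phi> (v1 Op)" "fixes_vertex \<phi> (v2 Op)"
    by blast
  then interpret lopsp_reflection Op \<phi> using assms by unfold_locales
  show "can_be_written_as_lsp Op" by (rule written_as_lsp)
qed

end
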